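(* Let $2\le p\le n$ be integers and let $I_p(C_n)\subseteq R=\Bbbk[x_1,\dots,x_n]$ be the $p$-path ideal of the $n$-cycle. Then $R/I_p(C_n)$ has a minimal generalized Barile–Macchia resolution; that is, there is a choice of total orders $(\succ_v)$ on the minimal generating set of $I_p(C_n)$, one for each monomial $v\in R$, such that the generalized Barile–Macchia resolution of $R/I_p(C_n)$ with respect to $(\succ_v)_v$ is minimal.
   Context: $\Bbbk$ is any field. $I_p(C_n)$ is generated by $m_i=x_ix_{i+1}\cdots x_{i+p-1}$, $1\le i\le n$, where indices of variables are taken modulo $n$. The following notions are for a monomial ideal $I$ with minimal generating set $\mathcal G(I)$. A cell is a subset of $\mathcal G(I)$; $\operatorname{lcm}(\emptyset)=1$. A bridge of a cell $\sigma$ is $m\in\sigma$ with $\operatorname{lcm}(\sigma\setminus m)=\operatorname{lcm}(\sigma)$. Given a total order $\succ$ on $\mathcal G(I)$, $\operatorname{sb}(\sigma)$ is the smallest bridge of $\sigma$ ($\emptyset$ if there is none). Let $G_X$ be the directed graph whose vertices are all cells and whose edges are $(\sigma,\sigma')$ with $\sigma'\subseteq\sigma$, $|\sigma'|=|\sigma|-1$. For a monomial $v\in R$ let $G_v$ be the induced subgraph of $G_X$ on the cells $\sigma$ with $\operatorname{lcm}(\sigma)=v$. Given a total order $\succ_v$ on $\mathcal G(I)$ for each monomial $v$, let $A_v$ be the edge set produced by the Barile–Macchia algorithm on $G_v$ with respect to $\succ_v$: start with $A_v=\emptyset$ and $\Omega=\{\sigma\in V(G_v):|\sigma|\ge3\}$;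 while $\Omega\neq\emptyset$, pick $\sigma\in\Omega$ of maximal cardinality, remove $\sigma$ and $\sigma\setminus\operatorname{sb}(\sigma)$ from $\Omega$, and if $\sigma$ has a bridge add the edge $(\sigma,\sigma\setminus\operatorname{sb}(\sigma))$ to $A_v$; afterwards, whenever two distinct edges $(\sigma,\tau),(\sigma',\tau)$ of $A_v$ have the same target and $\operatorname{sb}(\sigma')\succ_v\operatorname{sb}(\sigma)$, delete $(\sigma',\tau)$. Put $A=\bigcup_v A_v$. It is known that $A$ is a homogeneous acyclic matching, so it induces a Morse resolution $\mathcal F_A$ of $R/I$, called the generalized Barile–Macchia resolution with respect to $(\succ_v)_v$, defined as follows. A cell is $A$-critical if it appears in no edge of $A$. Let $G_X^A$ be obtained from $G_X$ by reversing the edges in $A$. Let $[\sigma:\sigma']=\pm1$ be the coefficient of $\sigma'$ in the simplicial boundary of $\sigma$. For an edge $(\sigma,\sigma')$ of $G_X^A$ put $m(\sigma,\sigma')=-[\sigma':\sigma]$ if $(\sigma',\sigma)\in A$ and $m(\sigma,\sigma')=[\sigma:\sigma']$ otherwise; for a directed path $\mathcal P$ in $G_X^A$ (a gradient path, possibly of length $0$) let $m(\mathcal P)$ be the product over its edges. Then $(\mathcal F_A)_r$ is the free $R$-module on the $A$-critical cells of cardinality $r$, with $$\partial^A_r(\sigma)=\sum_{\sigma'\subseteq\sigma,\ |\sigma'|=r-1}[\sigma:\sigma']\sum_{\sigma''\text{ critical},\ |\sigma''|=r-1}\ \sum_{\mathcal P:\sigma'\to\sigma''\text{ gradient path}} m(\mathcal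 P)\frac{\operatorname{lcm}(\sigma)}{\operatorname{lcm}(\sigma'')}\sigma''.$$ *)

theory Defs
  imports "HOL-Library.Poly_Mapping" "HOL-Algebra.Ideal"
begin

section \<open>Monomials and the polynomial ring\<close>

text \<open>
  Monomials are exponent vectors, written additively.  The variables of
  \<open>k[x\<^sub>1, \<dots>, x\<^sub>n]\<close> are indexed by the residues \<open>0, \<dots>, n - 1\<close> modulo \<open>n\<close>, so
  \<open>x\<^sub>n\<close> is the variable with index 0.
\<close>

type_synonym mono = "nat \<Rightarrow>\<^sub>0 nat"
type_synonym 'k mpoly = "mono \<Rightarrow>\<^sub>0 'k"
type_synonym cell = "mono set"

definition monomials :: "nat \<Rightarrow> mono set" where
  "monomials n = {u. Poly_Mapping.keys u \<subseteq> {..<n}}"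

definition poly_ring :: "nat \<Rightarrow> ('k::field) mpoly ring" where
  "poly_ring n =
     \<lparr>carrier = {f. Poly_Mapping.keys f \<subseteq> monomials n}, mult = (*), one = 1, zero = 0, add = (+)\<rparr>"

definition monom_poly :: "mono \<Rightarrow> ('k::field) mpoly" where
  "monom_poly u = Poly_Mapping.single u 1"

definition max_ideal :: "nat \<Rightarrow> ('k::field) mpoly set" where
  "max_ideal n = Idl\<^bsub>poly_ring n\<^esub> ((\<lambda>i. monom_poly (Poly_Mapping.single i 1)) ` {..<n})"

definition mono_dvd :: "mono \<Rightarrow> mono \<Rightarrow> bool" where
  "mono_dvd u w \<longleftrightarrow> (\<exists>q. w = u + q)"

text \<open>The minimal generating set of a monomial ideal \<open>I\<close>: the monomials of \<open>I\<close>
  that are minimal under divisibility.\<close>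

definition min_gens :: "nat \<Rightarrow> ('k::field) mpoly set \<Rightarrow> mono set" where
  "min_gens n I =
     {u \<in> monomials n. monom_poly u \<in> I \<and>
        (\<forall>w \<in> monomials n. monom_poly w \<in> I \<and> mono_dvd w u \<longrightarrow> w = u)}"

definition path_mono :: "nat \<Rightarrow> nat \<Rightarrow> nat \<Rightarrow> mono" where
  "path_mono n p i = (\<Sum>j = i..<i + p. Poly_Mapping.single (j mod n) 1)"

definition path_ideal :: "nat \<Rightarrow> nat \<Rightarrow> ('k::field) mpoly set" where
  "path_ideal n p = Idl\<^bsub>poly_ring n\<^esub> ((\<lambda>i. monom_poly (path_mono n p i)) ` {1..n})"

text \<open>The least common multiple of a finite set of monomials; inserting 0 makes the
  lcm of the empty cell the monomial 1.\<close>

definition mlcm :: "cell \<Rightarrow> mono" where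
  "mlcm \<sigma> = Abs_poly_mapping (\<lambda>i. Max (insert 0 ((\<lambda>m. Poly_Mapping.lookup m i) ` \<sigma>)))"


section \<open>The Barile--Macchia algorithm\<close>

text \<open>A total order \<open>\<succ>\<close> is given by the strict relation \<open>r\<close> with
  \<open>(a, b) \<in> r\<close> iff \<open>a \<succ> b\<close>.\<close>

definition bridges :: "cell \<Rightarrow> mono set" where
  "bridges \<sigma> = {m \<in> \<sigma>. mlcm (\<sigma> - {m}) = mlcm \<sigma>}"

text \<open>Meaningful only if \<open>\<sigma>\<close> has a bridge; it is used only in that case.\<close>

definition sb :: "mono rel \<Rightarrow> cell \<Rightarrow> mono" where
  "sb r \<sigma> = (THE m. m \<in> bridges \<sigma> \<and> (\<forall>m' \<in> bridges \<sigma>. m' \<noteq> m \<longrightarrow> (m', m) \<in> r))"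

definition cell_edges :: "mono set \<Rightarrow> (cell \<times> cell) set" where
  "cell_edges G = {(\<sigma>, \<sigma>'). \<sigma> \<subseteq> G \<and> \<sigma>' \<subseteq> \<sigma> \<and> card \<sigma>' + 1 = card \<sigma>}"

text \<open>The main loop.  Which cell of maximal cardinality is picked is irrelevant for the
  result, since handling a cell affects only that cell and one of smaller cardinality.
  Finiteness of \<open>\<Omega>\<close> is tested only to make the recursion total.\<close>

function bm_loop :: "mono rel \<Rightarrow> cell set \<Rightarrow> (cell \<times> cell) set \<Rightarrow> (cell \<times> cell) set" where
  "bm_loop r \<Omega> A =
     (if finite \<Omega> \<and> \<Omega> \<noteq> {} then
        let \<sigma> = arg_max_on card \<Omega> in
        if bridges \<sigma> = {} then bm_loop r (\<Omega> - {\<sigma>}) A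
        else bm_loop r (\<Omega> - {\<sigma>, \<sigma> - {sb r \<sigma>}}) (insert (\<sigma>, \<sigma> - {sb r \<sigma>}) A)
      else A)"
  by pat_completeness auto

lemma arg_max_on_card_mem:
  fixes \<Omega> :: "cell set"
  assumes "finite \<Omega>" "\<Omega> \<noteq> {}"
  shows "arg_max_on card \<Omega> \<in> \<Omega>"
proof -
  have "Max (card ` \<Omega>) \<in> card ` \<Omega>" using assms by simp
  then obtain x where x: "x \<in> \<Omega>" "card x = Max (card ` \<Omega>)" by auto
  have "is_arg_max card (\<lambda>x. x \<in> \<Omega>) x"
    using x assms by (simp add: is_arg_max_linorder)
  then have "is_arg_max card (\<lambda>x. x \<in> \<Omega>) (arg_max_on card \<Omega>)"
    unfolding arg_max_on_def arg_max_def by (rule someI)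
  then show ?thesis by (simp add: is_arg_max_def)
qed

termination bm_loop
  by (relation "measure (\<lambda>(r, \<Omega>, A). card \<Omega>)")
    (auto intro!: psubset_card_mono dest: arg_max_on_card_mem)

declare bm_loop.simps [simp del]

definition bm_edges :: "mono set \<Rightarrow> mono rel \<Rightarrow> mono \<Rightarrow> (cell \<times> cell) set" where
  "bm_edges G r v =
     (let A = bm_loop r {\<sigma>. \<sigma> \<subseteq> G \<and> mlcm \<sigma> = v \<and> card \<sigma> \<ge> 3} {}
      in {(\<sigma>', \<tau>) \<in> A. \<not> (\<exists>\<sigma>. (\<sigma>, \<tau>) \<in> A \<and> \<sigma> \<noteq> \<sigma>' \<and> (sb r \<sigma>', sb r \<sigma>) \<in> r)})"

definition gbm_matching ::
    "nat \<Rightarrow> mono set \<Rightarrow> (mono \<Rightarrow> mono rel) \<Rightarrow> (cell \<times> cell) set" where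
  "gbm_matching n G succ = (\<Union>v \<in> monomials n. bm_edges G (succ v) v)"


section \<open>The Morse complex of a matching\<close>

definition critical :: "mono set \<Rightarrow> (cell \<times> cell) set \<Rightarrow> nat \<Rightarrow> cell set" where
  "critical G A r =
     {\<sigma>. \<sigma> \<subseteq> G \<and> card \<sigma> = r \<and> (\<forall>\<tau>. (\<sigma>, \<tau>) \<notin> A \<and> (\<tau>, \<sigma>) \<notin> A)}"

text \<open>The simplicial boundary refers to the orientation of cells given by a fixed strict
  total order on the vertices, \<open>(a, b) \<in> ori\<close> meaning that \<open>a\<close> precedes \<open>b\<close>.\<close>

definition incidence :: "mono rel \<Rightarrow> cell \<Rightarrow> cell \<Rightarrow> 'k::field" where
  "incidence ori \<sigma> \<sigma>' =
     (if \<sigma>' \<subseteq> \<sigma> \<and> card \<sigma>' + 1 = card \<sigma>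
      then (- 1) ^ card {a \<in> \<sigma>. (a, the_elem (\<sigma> - \<sigma>')) \<in> ori} else 0)"

definition morse_edges :: "mono set \<Rightarrow> (cell \<times> cell) set \<Rightarrow> (cell \<times> cell) set" where
  "morse_edges G A = (cell_edges G - A) \<union> A\<inverse>"

definition edge_weight ::
    "mono rel \<Rightarrow> (cell \<times> cell) set \<Rightarrow> cell \<Rightarrow> cell \<Rightarrow> 'k::field" where
  "edge_weight ori A \<sigma> \<sigma>' =
     (if (\<sigma>', \<sigma>) \<in> A then - incidence ori \<sigma>' \<sigma> else incidence ori \<sigma> \<sigma>')"

text \<open>Paths are given by their vertex lists.  For an acyclic matching no directed walk
  repeats a vertex, so \<open>distinct\<close> excludes nothing; it makes the set of paths
  evidently finite.\<close>

definition gradient_paths ::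
    "mono set \<Rightarrow> (cell \<times> cell) set \<Rightarrow> cell \<Rightarrow> cell \<Rightarrow> cell list set" where
  "gradient_paths G A \<sigma> \<tau> =
     {P. P \<noteq> [] \<and> hd P = \<sigma> \<and> last P = \<tau> \<and> distinct P \<and>
         successively (\<lambda>a b. (a, b) \<in> morse_edges G A) P}"

definition path_weight :: "mono rel \<Rightarrow> (cell \<times> cell) set \<Rightarrow> cell list \<Rightarrow> 'k::field" where
  "path_weight ori A P = (\<Prod>(a, b) \<leftarrow> zip P (tl P). edge_weight ori A a b)"

text \<open>The coefficient of \<open>\<sigma>''\<close> in the differential of \<open>\<sigma>\<close>.  The subtraction is the
  quotient of monomials; it is exact whenever there is a path from a facet of \<open>\<sigma>\<close> to
  \<open>\<sigma>''\<close>, as lcms only go down along gradient paths of a homogeneous matching.\<close>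

definition morse_entry ::
    "mono set \<Rightarrow> (cell \<times> cell) set \<Rightarrow> mono rel \<Rightarrow> cell \<Rightarrow> cell \<Rightarrow> ('k::field) mpoly" where
  "morse_entry G A ori \<sigma> \<sigma>'' =
     (\<Sum>\<sigma>' \<in> {\<sigma>'. \<sigma>' \<subseteq> \<sigma> \<and> card \<sigma>' + 1 = card \<sigma>}.
        \<Sum>P \<in> gradient_paths G A \<sigma>' \<sigma>''.
          Poly_Mapping.single (mlcm \<sigma> - mlcm \<sigma>'') (incidence ori \<sigma> \<sigma>' * path_weight ori A P))"

text \<open>The free module on a finite set of cells: coefficient functions supported there.\<close>

definition free_module :: "nat \<Rightarrow> cell set \<Rightarrow> (cell \<Rightarrow> ('k::field) mpoly) set" where
  "free_module n C =
     {f. (\<forall>\<sigma>. f \<sigma> \<in> carrier (poly_ring n)) \<and> (\<forall>\<sigma>. \<sigma> \<notin> C \<longrightarrow> f \<sigma> = 0)}"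

definition morse_module ::
    "nat \<Rightarrow> mono set \<Rightarrow> (cell \<times> cell) set \<Rightarrow> nat \<Rightarrow> (cell \<Rightarrow> ('k::field) mpoly) set" where
  "morse_module n G A r = free_module n (critical G A r)"

definition morse_diff ::
    "mono set \<Rightarrow> (cell \<times> cell) set \<Rightarrow> mono rel \<Rightarrow> nat \<Rightarrow>
       (cell \<Rightarrow> ('k::field) mpoly) \<Rightarrow> (cell \<Rightarrow> 'k mpoly)" where
  "morse_diff G A ori r f =
     (\<lambda>\<sigma>''. if \<sigma>'' \<in> critical G A (r - 1)
            then \<Sum>\<sigma> \<in> critical G A r. f \<sigma> * morse_entry G A ori \<sigma> \<sigma>'' else 0)"


section \<open>Minimality\<close>

definition ideal_smult ::
    "('k::field) mpoly set \<Rightarrow> (cell \<Rightarrow> 'k mpoly) set \<Rightarrow> (cell \<Rightarrow> 'k mpoly) set" where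
  "ideal_smult J M =
     {h. \<exists>(N::nat) a g. (\<forall>i<N. a i \<in> J \<and> g i \<in> M) \<and> h = (\<lambda>\<tau>. \<Sum>i<N. a i * g i \<tau>)}"

text \<open>A graded free resolution is minimal if its differentials satisfy
  \<open>\<partial>(F\<^sub>r) \<subseteq> \<mm> F\<^bsub>r-1\<^esub>\<close> for all \<open>r \<ge> 1\<close>, where \<open>\<mm> = (x\<^sub>1, \<dots>, x\<^sub>n)\<close>.\<close>

definition minimal_complex ::
    "nat \<Rightarrow> (nat \<Rightarrow> (cell \<Rightarrow> ('k::field) mpoly) set) \<Rightarrow>
       (nat \<Rightarrow> (cell \<Rightarrow> 'k mpoly) \<Rightarrow> (cell \<Rightarrow> 'k mpoly)) \<Rightarrow> bool" where
  "minimal_complex n F d \<longleftrightarrow>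
     (\<forall>r \<ge> 1. d r ` F r \<subseteq> ideal_smult (max_ideal n) (F (r - 1)))"

definition gbm_minimal ::
    "nat \<Rightarrow> ('k::field) mpoly set \<Rightarrow> mono rel \<Rightarrow> (mono \<Rightarrow> mono rel) \<Rightarrow> bool" where
  "gbm_minimal n I ori succ \<longleftrightarrow>
     (let G = min_gens n I; A = gbm_matching n G succ in
        minimal_complex n
          (morse_module n G A :: nat \<Rightarrow> (cell \<Rightarrow> 'k mpoly) set)
          (morse_diff G A ori))"

end

theory Submission
  imports Defs
begin

text \<open>
  Entries of the Morse differential between critical cells of different lcm lie in the maximal
  ideal, so it suffices to choose the orders such that all critical cells with the same lcm \<open>v\<close> have
  the same cardinality.  Cut the cycle open in front of a vertex missing from \<open>v\<close> (anywhere, if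
  there is none) and order the generators linearly.  The algorithm then matches the cells by
  toggling the first generator, below the last one of the cell, that becomes the smallest bridge
  when added.  For each value of the last generator at most one cell survives, since only the last
  generator can interfere with the ones before it across the cut.  If \<open>v\<close> misses a vertex,
  all cells have the same last generator.  Otherwise, a surviving cell consists of two
  progressions with difference \<open>p + 1\<close>, and hence has \<open>2 n / (p + 1)\<close> or
  \<open>2 \<lfloor>n / (p + 1)\<rfloor> + 1\<close> vertices, depending on whether \<open>p + 1\<close> divides \<open>n\<close>.
\<close>

section \<open>Monomial ideals and minimality\<close>

text \<open>Toggling \<open>m\<close> could change which smaller generators can be toggled, and then
  it would be no involution. On the cut cycle, arcs \<open>b\<close>, \<open>m\<close>,
  \<open>x\<close>, \<open>a\<close> of increasing rank obey one rule: a vertex shared by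
  \<open>b\<close> and \<open>x\<close> lies in \<open>m\<close> or, past the cut, in
  \<open>a\<close>, because the wrapped ends are nested. So in the presence of \<open>m\<close> and
  \<open>a\<close> the generator \<open>x\<close> cannot decide whether \<open>b\<close> is a
  bridge. Keeping the last generator fixed makes this rule available.

  The algorithm knows nothing of toggles. It also handles toggle-free cells, whose only possible
  bridge is the last generator. Their edges may share targets with the wanted ones, but have a
  larger smallest bridge and lose in the final clean-up.

  The difference \<open>p + 1\<close> results from two opposite conditions on consecutive
  \<open>s\<close>, \<open>t\<close> and the generator after them: starting at \<open>s + p\<close>
  or earlier, it would make \<open>t\<close> redundant together with \<open>s\<close>; and if
  \<open>s + p + 1\<close> were free, inserting it would be a toggle. When no vertex is missing, the
  lcm no longer tells what the last generator is, so cells are compared by counting.\<close>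

lemma monomials_add: "u \<in> monomials n \<Longrightarrow> w \<in> monomials n \<Longrightarrow> u + w \<in> monomials n"
  unfolding monomials_def using keys_add[of u w] by blast

lemma monomials_single: "i < n \<Longrightarrow> Poly_Mapping.single i k \<in> monomials n"
  by (auto simp: monomials_def)

lemma monomials_zero: "0 \<in> monomials n"
  by (simp add: monomials_def)

section \<open>The polynomial ring and its ideals\<close>

lemma poly_ring_simps [simp]:
  "carrier (poly_ring n) = {f. Poly_Mapping.keys f \<subseteq> monomials n}"
  "x \<otimes>\<^bsub>poly_ring n\<^esub> y = x * y" "x \<oplus>\<^bsub>poly_ring n\<^esub> y = x + y"
  "\<one>\<^bsub>poly_ring n\<^esub> = 1" "\<zero>\<^bsub>poly_ring n\<^esub> = 0"
  by (simp_all add: poly_ring_def)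

lemma keys_mult_monomials:
  "Poly_Mapping.keys f \<subseteq> monomials n \<Longrightarrow> Poly_Mapping.keys g \<subseteq> monomials n
    \<Longrightarrow> Poly_Mapping.keys (f * g) \<subseteq> monomials n"
  using keys_mult[of f g] monomials_add by fastforce

lemma keys_add_monomials:
  "Poly_Mapping.keys f \<subseteq> monomials n \<Longrightarrow> Poly_Mapping.keys g \<subseteq> monomials n
    \<Longrightarrow> Poly_Mapping.keys (f + g) \<subseteq> monomials n"
  using keys_add[of f g] by blast

lemma cring_poly_ring: "cring (poly_ring n :: ('k::field) mpoly ring)"
proof (rule cringI)
  show "abelian_group (poly_ring n :: 'k mpoly ring)"
  proof (rule abelian_groupI)
    fix x :: "'k mpoly" assume "x \<in> carrier (poly_ring n)"
    then show "\<exists>y\<in>carrier (poly_ring n). y \<oplus>\<^bsub>poly_ring n\<^esub> x = \<zero>\<^bsub>poly_ring n\<^esub>"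
      by (intro bexI[of _ "- x"]) auto
  qed (auto simp: keys_add_monomials algebra_simps dest: keys_add_monomials)
  show "comm_monoid (poly_ring n :: 'k mpoly ring)"
    by (rule comm_monoidI)
      (auto simp: algebra_simps monomials_zero dest: keys_mult_monomials)
qed (auto simp: algebra_simps)

lemma ring_poly_ring: "ring (poly_ring n :: ('k::field) mpoly ring)"
  using cring_poly_ring by (rule cring.axioms(1))

text \<open>Negatives are multiples by \<open>- 1\<close>, so sums and products are all there is to
  check.\<close>

lemma poly_ring_idealI:
  fixes J :: "('k::field) mpoly set"
  assumes "J \<subseteq> carrier (poly_ring n)" "0 \<in> J"
    "\<And>a b. a \<in> J \<Longrightarrow> b \<in> J \<Longrightarrow> a + b \<in> J"
    "\<And>a x. a \<in> J \<Longrightarrow> x \<in> carrier (poly_ring n) \<Longrightarrow> x * a \<in> J"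
  shows "ideal J (poly_ring n)"
proof -
  interpret R: cring "poly_ring n :: 'k mpoly ring" by (rule cring_poly_ring)
  have neg: "- a \<in> J" if "a \<in> J" for a
    using assms(4)[of a "- 1"] that by (simp add: monomials_zero)
  have inv: "\<ominus>\<^bsub>poly_ring n\<^esub> a = - a" if "a \<in> carrier (poly_ring n)" for a :: "'k mpoly"
    using that by (intro R.minus_equality) auto
  show ?thesis
  proof (rule idealI[OF R.ring_axioms])
    show "subgroup J (add_monoid (poly_ring n))"
    proof (rule R.add.subgroupI)
      fix a assume "a \<in> J"
      then show "\<ominus>\<^bsub>poly_ring n\<^esub> a \<in> J" using neg inv assms(1) by force
    qed (use assms in auto)
  qed (use assms(4) in \<open>auto simp: mult.commute\<close>)
qed

section \<open>Divisibility and minimal generators of monomial ideals\<close>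

lemma mono_dvd_iff: "mono_dvd u w \<longleftrightarrow> (\<forall>i. Poly_Mapping.lookup u i \<le> Poly_Mapping.lookup w i)"
proof
  assume *: "\<forall>i. Poly_Mapping.lookup u i \<le> Poly_Mapping.lookup w i"
  have "w = u + (w - u)"
    by (rule poly_mapping_eqI) (use * in \<open>simp add: lookup_add lookup_minus\<close>)
  then show "mono_dvd u w" unfolding mono_dvd_def by blast
qed (auto simp: mono_dvd_def lookup_add)

lemma keys_monom_poly: "Poly_Mapping.keys (monom_poly u :: ('k::field) mpoly) = {u}"
  by (simp add: monom_poly_def)

text \<open>The polynomials all of whose terms are divisible by elements of \<open>S\<close> form an
  ideal containing the generators, hence everything generated by them; a monomial has only one term
  to test.\<close>

lemma monom_poly_in_Idl:
  fixes S :: "mono set"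
  assumes S: "S \<subseteq> monomials n"
    and u: "monom_poly u \<in> (Idl\<^bsub>poly_ring n\<^esub> ((monom_poly :: mono \<Rightarrow> ('k::field) mpoly) ` S))"
  shows "\<exists>s\<in>S. mono_dvd s u"
proof -
  let ?J = "{f :: 'k mpoly. Poly_Mapping.keys f \<subseteq> monomials n \<and>
     (\<forall>w \<in> Poly_Mapping.keys f. \<exists>s\<in>S. mono_dvd s w)}"
  have "ideal ?J (poly_ring n)"
  proof (rule poly_ring_idealI)
    fix a b assume "a \<in> ?J" "b \<in> ?J"
    then show "a + b \<in> ?J" using keys_add[of a b] by blast
  next
    fix a x :: "'k mpoly" assume a: "a \<in> ?J" and x: "x \<in> carrier (poly_ring n)"
    have "\<exists>s\<in>S. mono_dvd s w" if w: "w \<in> Poly_Mapping.keys (x * a)" for w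
    proof -
      obtain c d where "w = c + d" "d \<in> Poly_Mapping.keys a"
        using keys_mult[of x a] w by blast
      moreover obtain s where "s \<in> S" "mono_dvd s d" using a calculation by blast
      ultimately show ?thesis by (auto simp: mono_dvd_iff lookup_add intro!: bexI[of _ s] trans_le_add2)
    qed
    then show "x * a \<in> ?J" using keys_mult_monomials[of x n a] a x by auto
  qed auto
  moreover have "monom_poly ` S \<subseteq> ?J"
    using S by (auto simp: keys_monom_poly mono_dvd_iff)
  ultimately have "monom_poly u \<in> ?J" using u unfolding genideal_def by blast
  then show ?thesis by (auto simp: keys_monom_poly)
qed

lemma monom_poly_gen_in_Idl:
  assumes "S \<subseteq> monomials n" "s \<in> S"
  shows "monom_poly s \<in> (Idl\<^bsub>poly_ring n\<^esub> ((monom_poly :: mono \<Rightarrow> ('k::field) mpoly) ` S))"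
proof -
  have "monom_poly ` S \<subseteq> (Idl\<^bsub>poly_ring n\<^esub> ((monom_poly :: mono \<Rightarrow> 'k mpoly) ` S))"
    by (rule ring.genideal_self[OF ring_poly_ring]) (use assms in \<open>auto simp: keys_monom_poly\<close>)
  then show ?thesis using assms by blast
qed

lemma min_gens_monomial_ideal:
  assumes S: "S \<subseteq> monomials n"
    and antichain: "\<And>s t. s \<in> S \<Longrightarrow> t \<in> S \<Longrightarrow> mono_dvd s t \<Longrightarrow> s = t"
  shows "min_gens n (Idl\<^bsub>poly_ring n\<^esub> ((monom_poly :: mono \<Rightarrow> ('k::field) mpoly) ` S)) = S"
    (is "min_gens n ?I = S")
proof (intro equalityI subsetI)
  fix u assume u: "u \<in> min_gens n ?I"
  then obtain s where s: "s \<in> S" "mono_dvd s u"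
    unfolding min_gens_def using monom_poly_in_Idl[OF S] by blast
  then have "monom_poly s \<in> ?I" using monom_poly_gen_in_Idl[OF S] by blast
  then have "s = u" using u s S unfolding min_gens_def by blast
  then show "u \<in> S" using s by simp
next
  fix s assume s: "s \<in> S"
  have "w = s" if w: "monom_poly w \<in> ?I" "mono_dvd w s" for w
  proof -
    obtain t where t: "t \<in> S" "mono_dvd t w" using monom_poly_in_Idl[OF S w(1)] by blast
    have "mono_dvd t s" using t(2) w(2) unfolding mono_dvd_iff by (meson le_trans)
    then have "t = s" using antichain t s by blast
    then show ?thesis using t(2) w(2) unfolding mono_dvd_iff
      by (intro poly_mapping_eqI le_antisym) auto
  qed
  then show "s \<in> min_gens n ?I"
    unfolding min_gens_def using s S monom_poly_gen_in_Idl[OF S s] by blast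
qed

lemma ideal_max_ideal: "ideal (max_ideal n :: ('k::field) mpoly set) (poly_ring n)"
  unfolding max_ideal_def
  by (rule ring.genideal_ideal[OF ring_poly_ring])
    (auto simp: keys_monom_poly monomials_single)

text \<open>A variable occurring in \<open>u\<close> is split off; what remains is a monomial of the
  ring.\<close>

lemma single_in_max_ideal:
  assumes u: "u \<in> monomials n" "u \<noteq> 0"
  shows "Poly_Mapping.single u (c::'k::field) \<in> max_ideal n"
proof -
  obtain i where i: "i \<in> Poly_Mapping.keys u" using u(2) by (metis keys_eq_empty equals0I)
  then have "i < n" using u(1) by (auto simp: monomials_def)
  let ?x = "Poly_Mapping.single i 1 :: mono"
  have eq: "u = (u - ?x) + ?x"
    using i by (intro poly_mapping_eqI)
      (auto simp: lookup_add lookup_minus lookup_single when_def in_keys_iff)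
  have "(monom_poly ?x :: 'k mpoly) \<in>
      Idl\<^bsub>poly_ring n\<^esub> (monom_poly ` (\<lambda>i. Poly_Mapping.single i 1) ` {..<n})"
    by (rule monom_poly_gen_in_Idl) (use \<open>i < n\<close> in \<open>auto simp: monomials_single\<close>)
  then have "monom_poly ?x \<in> (max_ideal n :: 'k mpoly set)"
    by (simp only: max_ideal_def image_image)
  moreover have "u - ?x \<in> monomials n"
    using u(1) unfolding monomials_def by (auto simp: in_keys_iff lookup_minus subset_iff)
  ultimately have "Poly_Mapping.single (u - ?x) c \<otimes>\<^bsub>poly_ring n\<^esub> monom_poly ?x \<in> max_ideal n"
    by (intro ideal.I_l_closed[OF ideal_max_ideal]) auto
  then show ?thesis using eq by (simp add: monom_poly_def mult_single)
qed

lemma sum_in_max_ideal: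
  assumes "\<And>x. x \<in> X \<Longrightarrow> f x \<in> (max_ideal n :: ('k::field) mpoly set)"
  shows "sum f X \<in> max_ideal n"
proof -
  have sub: "additive_subgroup (max_ideal n :: 'k mpoly set) (poly_ring n)"
    using ideal_max_ideal by (rule ideal.axioms(1))
  show ?thesis using assms
    by (induction X rule: infinite_finite_induct)
      (use additive_subgroup.zero_closed[OF sub] additive_subgroup.a_closed[OF sub] in auto)
qed

section \<open>Least common multiples and the Morse differential\<close>

lemma lookup_mlcm:
  assumes "finite \<sigma>"
  shows "Poly_Mapping.lookup (mlcm \<sigma>) i = Max (insert 0 ((\<lambda>m. Poly_Mapping.lookup m i) ` \<sigma>))"
proof -
  let ?f = "\<lambda>i. Max (insert 0 ((\<lambda>m. Poly_Mapping.lookup m i) ` \<sigma>))"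
  \<comment> \<open>\<open>Abs_poly_mapping\<close> is faithful only on functions of finite
    support.\<close>
  have "{i. ?f i \<noteq> 0} \<subseteq> (\<Union>m\<in>\<sigma>. Poly_Mapping.keys m)"
  proof
    fix i assume "i \<in> {i. ?f i \<noteq> 0}"
    moreover have "?f i \<in> insert 0 ((\<lambda>m. Poly_Mapping.lookup m i) ` \<sigma>)"
      by (rule Max_in) (use assms in auto)
    ultimately show "i \<in> (\<Union>m\<in>\<sigma>. Poly_Mapping.keys m)" by (auto simp: in_keys_iff)
  qed
  then have "finite {i. ?f i \<noteq> 0}" by (rule finite_subset) (use assms in auto)
  then show ?thesis unfolding mlcm_def by simp
qed

lemma lookup_mlcm_mono:
  assumes "finite \<sigma>" "\<tau> \<subseteq> \<sigma>"
  shows "Poly_Mapping.lookup (mlcm \<tau>) i \<le> Poly_Mapping.lookup (mlcm \<sigma>) i"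
  using assms finite_subset[OF assms(2,1)] by (auto simp: lookup_mlcm intro!: Max_mono)

lemma keys_mlcm: "finite \<sigma> \<Longrightarrow> Poly_Mapping.keys (mlcm \<sigma>) = (\<Union>m\<in>\<sigma>. Poly_Mapping.keys m)"
  by (auto simp: in_keys_iff lookup_mlcm Max_eq_iff simp del: neq0_conv)

lemma mlcm_in_monomials:
  assumes "finite \<sigma>" "\<sigma> \<subseteq> monomials n"
  shows "mlcm \<sigma> \<in> monomials n"
  using assms by (auto simp: monomials_def keys_mlcm)

text \<open>A step of a path either drops a generator, which can only lower the lcm, or runs back
  along a matched edge, where homogeneity keeps it.\<close>

lemma gradient_path_lookup_le:
  assumes fin: "finite G" and hom: "\<And>\<sigma> \<tau>. (\<sigma>, \<tau>) \<in> A \<Longrightarrow> mlcm \<sigma> = mlcm \<tau>"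
    and P: "P \<in> gradient_paths G A \<sigma> \<tau>"
  shows "Poly_Mapping.lookup (mlcm \<tau>) i \<le> Poly_Mapping.lookup (mlcm \<sigma>) i"
proof -
  have step: "Poly_Mapping.lookup (mlcm b) i \<le> Poly_Mapping.lookup (mlcm a) i"
    if "(a, b) \<in> morse_edges G A" for a b
    using that hom lookup_mlcm_mono[of a b] finite_subset[OF _ fin]
    by (fastforce simp: morse_edges_def cell_edges_def)
  have "Poly_Mapping.lookup (mlcm (last P)) i \<le> Poly_Mapping.lookup (mlcm (hd P)) i"
    if "P \<noteq> []" "successively (\<lambda>a b. (a, b) \<in> morse_edges G A) P" for P
    using that
  proof (induction P rule: induct_list012)
    case (3 x y zs)
    then show ?case using step[of x y] by (auto intro: le_trans)
  qed auto
  then show ?thesis using P unfolding gradient_paths_def by auto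
qed

text \<open>Only cells with equal lcm can be joined by a unit entry, so it suffices that critical cells
  with equal lcm never lie in adjacent homological degrees.\<close>

lemma minimal_complexI:
  fixes ori :: "mono rel"
  assumes fin: "finite G" and G: "G \<subseteq> monomials n"
    and hom: "\<And>\<sigma> \<tau>. (\<sigma>, \<tau>) \<in> A \<Longrightarrow> mlcm \<sigma> = mlcm \<tau>"
    and crit: "\<And>r s \<sigma> \<tau>. \<sigma> \<in> critical G A r \<Longrightarrow> \<tau> \<in> critical G A s \<Longrightarrow> mlcm \<sigma> = mlcm \<tau> \<Longrightarrow> r = s"
  shows "minimal_complex n (morse_module n G A :: nat \<Rightarrow> (cell \<Rightarrow> ('k::field) mpoly) set)
    (morse_diff G A ori)"
  unfolding minimal_complex_def
proof (intro allI impI image_subsetI)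
  fix r :: nat and f :: "cell \<Rightarrow> 'k mpoly"
  assume r: "1 \<le> r" and f: "f \<in> morse_module n G A r"
  let ?C = "critical G A r" and ?D = "critical G A (r - 1)"
  have finC: "finite (critical G A k)" for k
    by (rule finite_subset[of _ "Pow G"]) (auto simp: critical_def fin)
  have entry: "(morse_entry G A ori \<sigma> \<tau> :: 'k mpoly) \<in> max_ideal n" if "\<sigma> \<in> ?C" "\<tau> \<in> ?D" for \<sigma> \<tau>
    unfolding morse_entry_def
  proof (intro sum_in_max_ideal single_in_max_ideal)
    fix \<sigma>' P assume \<sigma>': "\<sigma>' \<in> {\<sigma>'. \<sigma>' \<subseteq> \<sigma> \<and> card \<sigma>' + 1 = card \<sigma>}"
      and P: "P \<in> gradient_paths G A \<sigma>' \<tau>"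
    have sub: "\<sigma> \<subseteq> G" "\<tau> \<subseteq> G" using that by (auto simp: critical_def)
    have fins: "finite \<sigma>" "finite \<tau>" using sub fin finite_subset by auto
    have "mlcm \<sigma> \<in> monomials n"
      using sub G fins by (intro mlcm_in_monomials) auto
    then show "mlcm \<sigma> - mlcm \<tau> \<in> monomials n"
      unfolding monomials_def by (auto simp: in_keys_iff lookup_minus subset_iff)
    have le: "Poly_Mapping.lookup (mlcm \<tau>) i \<le> Poly_Mapping.lookup (mlcm \<sigma>) i" for i
      using gradient_path_lookup_le[OF fin hom P, of i] lookup_mlcm_mono[OF fins(1), of \<sigma>' i] \<sigma>'
      by force
    \<comment> \<open>The cells have cardinalities \<open>r\<close> and \<open>r - 1\<close>, which
      differ because \<open>1 \<le> r\<close>.\<close>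
    have "mlcm \<sigma> \<noteq> mlcm \<tau>" using crit[OF that] r by fastforce
    then obtain i where "Poly_Mapping.lookup (mlcm \<sigma>) i \<noteq> Poly_Mapping.lookup (mlcm \<tau>) i"
      by (meson poly_mapping_eqI)
    then have "Poly_Mapping.lookup (mlcm \<sigma> - mlcm \<tau>) i \<noteq> 0"
      using le[of i] by (simp add: lookup_minus)
    then show "mlcm \<sigma> - mlcm \<tau> \<noteq> 0" by force
  qed
  have "finite (?C \<times> ?D)" using finC by blast
  then obtain e where e: "bij_betw e {..<card (?C \<times> ?D)} (?C \<times> ?D)"
    using ex_bij_betw_nat_finite lessThan_atLeast0 by metis
  let ?N = "card (?C \<times> ?D)"
  \<comment> \<open>Each pair of critical cells gives one summand: its entry is the coefficient in
    the ideal, and \<open>f \<sigma>\<close> placed at the basis cell \<open>\<tau>\<close> is the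
    module element.\<close>
  let ?a = "\<lambda>i. case e i of (\<sigma>, \<tau>) \<Rightarrow> (morse_entry G A ori \<sigma> \<tau> :: 'k mpoly)"
  let ?g = "\<lambda>i \<upsilon>. case e i of (\<sigma>, \<tau>) \<Rightarrow> if \<upsilon> = \<tau> then f \<sigma> else 0"
  have ei: "e i \<in> ?C \<times> ?D" if "i < ?N" for i using e that by (auto simp: bij_betw_def)
  have "?a i \<in> max_ideal n \<and> ?g i \<in> morse_module n G A (r - 1)" if "i < ?N" for i
    using ei[OF that] entry f
    by (auto simp: morse_module_def free_module_def subset_iff split: if_splits)
  moreover have "morse_diff G A ori r f = (\<lambda>\<upsilon>. \<Sum>i<?N. ?a i * ?g i \<upsilon>)"
  proof
    fix \<upsilon>
    have "(\<Sum>i<?N. ?a i * ?g i \<upsilon>) = (\<Sum>(\<sigma>, \<tau>) \<in> ?C \<times> ?D.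
        morse_entry G A ori \<sigma> \<tau> * (if \<upsilon> = \<tau> then f \<sigma> else 0))"
      using sum.reindex_bij_betw[OF e, of "\<lambda>(\<sigma>, \<tau>). morse_entry G A ori \<sigma> \<tau> * (if \<upsilon> = \<tau> then f \<sigma> else 0)"]
      by (simp add: case_prod_unfold)
    also have "\<dots> = (\<Sum>\<sigma>\<in>?C. \<Sum>\<tau>\<in>?D. if \<tau> = \<upsilon> then f \<sigma> * morse_entry G A ori \<sigma> \<tau> else 0)"
      unfolding sum.cartesian_product[symmetric] by (intro sum.cong) (auto simp: mult.commute)
    also have "\<dots> = morse_diff G A ori r f \<upsilon>"
      using finC by (simp add: morse_diff_def sum.delta)
    finally show "morse_diff G A ori r f \<upsilon> = (\<Sum>i<?N. ?a i * ?g i \<upsilon>)" by simp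
  qed
  ultimately show "morse_diff G A ori r f \<in> ideal_smult (max_ideal n) (morse_module n G A (r - 1))"
    unfolding ideal_smult_def
    by (intro CollectI exI[of _ ?N] exI[of _ ?a] exI[of _ ?g]) blast
qed


section \<open>The Barile--Macchia algorithm for rank orders\<close>

text \<open>A larger rank means larger in the order, so the smallest bridge is the one of least
  rank.\<close>

definition rank_order :: "mono set \<Rightarrow> (mono \<Rightarrow> nat) \<Rightarrow> mono rel" where
  "rank_order G \<rho> = {(a, b). a \<in> G \<and> b \<in> G \<and> \<rho> b < \<rho> a}"

lemma strict_linear_order_rank_order:
  "inj_on \<rho> G \<Longrightarrow> strict_linear_order_on G (rank_order G \<rho>)"
  unfolding strict_linear_order_on_def rank_order_def trans_def irrefl_def total_on_def
  by (auto simp: inj_on_def not_less order.order_iff_strict)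

lemma bridges_subset: "bridges \<sigma> \<subseteq> \<sigma>"
  by (auto simp: bridges_def)

lemma sb_rank_order_eqI:
  assumes "\<sigma> \<subseteq> G" "m \<in> bridges \<sigma>" "\<And>b. b \<in> bridges \<sigma> \<Longrightarrow> \<rho> m \<le> \<rho> b" "inj_on \<rho> G"
  shows "sb (rank_order G \<rho>) \<sigma> = m"
  unfolding sb_def
proof (rule the_equality)
  have G: "b \<in> G" if "b \<in> bridges \<sigma>" for b using that assms(1) bridges_subset by blast
  show "m \<in> bridges \<sigma> \<and> (\<forall>m'\<in>bridges \<sigma>. m' \<noteq> m \<longrightarrow> (m', m) \<in> rank_order G \<rho>)"
    using assms G by (auto simp: rank_order_def inj_on_def order.strict_iff_order)
  fix m' assume "m' \<in> bridges \<sigma> \<and> (\<forall>m\<in>bridges \<sigma>. m \<noteq> m' \<longrightarrow> (m, m') \<in> rank_order G \<rho>)"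
  then show "m' = m"
    using assms(2,3) by (force simp: rank_order_def)
qed

lemma sb_rank_order:
  assumes "\<sigma> \<subseteq> G" "bridges \<sigma> \<noteq> {}" "inj_on \<rho> G"
  shows "sb (rank_order G \<rho>) \<sigma> \<in> bridges \<sigma>"
    and "b \<in> bridges \<sigma> \<Longrightarrow> \<rho> (sb (rank_order G \<rho>) \<sigma>) \<le> \<rho> b"
proof -
  obtain m where m: "m \<in> bridges \<sigma>" "\<And>b. b \<in> bridges \<sigma> \<Longrightarrow> \<rho> m \<le> \<rho> b"
    using assms(2) ex_has_least_nat[of "\<lambda>m. m \<in> bridges \<sigma>" _ \<rho>] by blast
  have "sb (rank_order G \<rho>) \<sigma> = m" using assms m by (intro sb_rank_order_eqI)
  then show "sb (rank_order G \<rho>) \<sigma> \<in> bridges \<sigma>"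
    and "b \<in> bridges \<sigma> \<Longrightarrow> \<rho> (sb (rank_order G \<rho>) \<sigma>) \<le> \<rho> b" using m by auto
qed

lemma bm_loop_empty: "bm_loop r {} A = A"
  by (subst bm_loop.simps) simp

text \<open>Hides the choice made by \<open>arg_max_on\<close>: later arguments use only that the
  processed cell has maximal cardinality.\<close>

lemma bm_loop_step:
  assumes fin: "finite \<Omega>" and ne: "\<Omega> \<noteq> {}"
  obtains \<sigma> where "\<sigma> \<in> \<Omega>" "\<And>\<tau>. \<tau> \<in> \<Omega> \<Longrightarrow> card \<tau> \<le> card \<sigma>"
    "bridges \<sigma> = {} \<Longrightarrow> bm_loop r \<Omega> A = bm_loop r (\<Omega> - {\<sigma>}) A"
    "bridges \<sigma> \<noteq> {} \<Longrightarrow> bm_loop r \<Omega> A =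
      bm_loop r (\<Omega> - {\<sigma>, \<sigma> - {sb r \<sigma>}}) (insert (\<sigma>, \<sigma> - {sb r \<sigma>}) A)"
proof
  let ?\<sigma> = "arg_max_on card \<Omega>"
  show "?\<sigma> \<in> \<Omega>" using fin ne by (rule arg_max_on_card_mem)
  have "is_arg_max card (\<lambda>x. x \<in> \<Omega>) ?\<sigma>"
  proof -
    obtain x where "x \<in> \<Omega>" "card x = Max (card ` \<Omega>)"
      using Max_in[of "card ` \<Omega>"] fin ne by fastforce
    then have "is_arg_max card (\<lambda>x. x \<in> \<Omega>) x"
      using fin by (simp add: is_arg_max_linorder)
    then show ?thesis unfolding arg_max_on_def arg_max_def by (rule someI)
  qed
  then show "card \<tau> \<le> card ?\<sigma>" if "\<tau> \<in> \<Omega>" for \<tau>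
    using that by (simp add: is_arg_max_linorder)
  show "bm_loop r \<Omega> A = bm_loop r (\<Omega> - {?\<sigma>}) A" if "bridges ?\<sigma> = {}"
    using that fin ne by (subst bm_loop.simps) (simp add: Let_def)
  show "bm_loop r \<Omega> A =
      bm_loop r (\<Omega> - {?\<sigma>, ?\<sigma> - {sb r ?\<sigma>}}) (insert (?\<sigma>, ?\<sigma> - {sb r ?\<sigma>}) A)" if "bridges ?\<sigma> \<noteq> {}"
    using that fin ne by (subst bm_loop.simps) (simp add: Let_def)
qed

text \<open>\<open>Up\<close> and \<open>Dn\<close> are matched with each other by removing the smallest bridge.  Since cells are
  processed by decreasing cardinality, a cell of \<open>Dn\<close> is always removed before its turn.\<close>

lemma bm_loop_matching:
  assumes "finite \<Omega>" "\<And>\<sigma>. \<sigma> \<in> \<Omega> \<Longrightarrow> finite \<sigma>"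
    and Up: "\<And>\<sigma>. \<sigma> \<in> Up \<Longrightarrow> bridges \<sigma> \<noteq> {} \<and> sb r \<sigma> \<in> \<sigma> \<and> \<sigma> - {sb r \<sigma>} \<in> Dn"
    and "\<And>\<tau>. \<tau> \<in> Dn \<Longrightarrow> \<tau> \<in> \<Omega> \<Longrightarrow> \<exists>\<sigma> \<in> Up \<inter> \<Omega>. \<sigma> - {sb r \<sigma>} = \<tau>"
    and disj: "Up \<inter> Dn = {}"
    and "\<And>\<sigma>. \<sigma> \<in> \<Omega> \<Longrightarrow> \<sigma> \<notin> Up \<Longrightarrow> \<sigma> \<notin> Dn \<Longrightarrow> bridges \<sigma> \<noteq> {} \<Longrightarrow> \<sigma> - {sb r \<sigma>} \<notin> Up"
  shows "A \<subseteq> bm_loop r \<Omega> A \<and> (\<forall>\<sigma> \<in> Up \<inter> \<Omega>. (\<sigma>, \<sigma> - {sb r \<sigma>}) \<in> bm_loop r \<Omega> A) \<and>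
    (\<forall>\<sigma> \<tau>. (\<sigma>, \<tau>) \<in> bm_loop r \<Omega> A \<longrightarrow> (\<sigma>, \<tau>) \<notin> A \<longrightarrow>
       \<sigma> \<in> \<Omega> \<and> \<sigma> \<notin> Dn \<and> bridges \<sigma> \<noteq> {} \<and> \<tau> = \<sigma> - {sb r \<sigma>})"
  using assms(1,2,4,6)
proof (induction \<Omega> arbitrary: A rule: finite_psubset_induct)
  case (psubset \<Omega> A)
  note fin = psubset.prems(1) and Dn = psubset.prems(2) and C = psubset.prems(3)
  show ?case
  proof (cases "\<Omega> = {}")
    case True
    then show ?thesis by (simp add: bm_loop_empty)
  next
    case False
    obtain \<sigma> where \<sigma>: "\<sigma> \<in> \<Omega>" and max: "\<And>\<tau>. \<tau> \<in> \<Omega> \<Longrightarrow> card \<tau> \<le> card \<sigma>"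
      and nobr: "bridges \<sigma> = {} \<Longrightarrow> bm_loop r \<Omega> A = bm_loop r (\<Omega> - {\<sigma>}) A"
      and hasbr: "bridges \<sigma> \<noteq> {} \<Longrightarrow> bm_loop r \<Omega> A =
      bm_loop r (\<Omega> - {\<sigma>, \<sigma> - {sb r \<sigma>}}) (insert (\<sigma>, \<sigma> - {sb r \<sigma>}) A)"
      by (rule bm_loop_step[OF psubset.hyps False, where r = r and A = A], rule that)
    have nDn: "\<sigma> \<notin> Dn"
    proof
      assume "\<sigma> \<in> Dn"
      then obtain T where T: "T \<in> Up" "T \<in> \<Omega>" "T - {sb r T} = \<sigma>" using Dn \<sigma> by blast
      then have "card \<sigma> < card T"
        using fin[OF T(2)] Up[OF T(1)] by (metis card_Diff1_less)
      then show False using max[OF T(2)] by simp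
    qed
    show ?thesis
    proof (cases "bridges \<sigma> = {}")
      case True
      let ?\<Omega> = "\<Omega> - {\<sigma>}"
      have nUp: "\<sigma> \<notin> Up" using Up True by blast
      have "A \<subseteq> bm_loop r ?\<Omega> A \<and> (\<forall>\<sigma> \<in> Up \<inter> ?\<Omega>. (\<sigma>, \<sigma> - {sb r \<sigma>}) \<in> bm_loop r ?\<Omega> A) \<and>
        (\<forall>\<sigma> \<tau>. (\<sigma>, \<tau>) \<in> bm_loop r ?\<Omega> A \<longrightarrow> (\<sigma>, \<tau>) \<notin> A \<longrightarrow>
          \<sigma> \<in> ?\<Omega> \<and> \<sigma> \<notin> Dn \<and> bridges \<sigma> \<noteq> {} \<and> \<tau> = \<sigma> - {sb r \<sigma>})"
      proof (rule psubset.IH)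
        show "?\<Omega> \<subset> \<Omega>" using \<sigma> by blast
        show "\<exists>T \<in> Up \<inter> ?\<Omega>. T - {sb r T} = \<tau>" if "\<tau> \<in> Dn" "\<tau> \<in> ?\<Omega>" for \<tau>
          using Dn[of \<tau>] that nUp by blast
      qed (use fin C in blast)+
      then show ?thesis unfolding nobr[OF True] using nUp by blast
    next
      case br: False
      let ?h = "\<sigma> - {sb r \<sigma>}"
      let ?\<Omega> = "\<Omega> - {\<sigma>, ?h}" and ?A = "insert (\<sigma>, ?h) A"
      \<comment> \<open>The facet dropped along with \<open>\<sigma>\<close> is never in
        \<open>Up\<close>: if \<open>\<sigma>\<close> is in \<open>Up\<close>, it lies in
        \<open>Dn\<close>, and otherwise the last hypothesis excludes it.\<close>
      have nUp: "?h \<notin> Up" using Up[of \<sigma>] disj C[OF \<sigma>] nDn br by blast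
      have "?A \<subseteq> bm_loop r ?\<Omega> ?A \<and> (\<forall>\<sigma> \<in> Up \<inter> ?\<Omega>. (\<sigma>, \<sigma> - {sb r \<sigma>}) \<in> bm_loop r ?\<Omega> ?A) \<and>
        (\<forall>\<sigma> \<tau>. (\<sigma>, \<tau>) \<in> bm_loop r ?\<Omega> ?A \<longrightarrow> (\<sigma>, \<tau>) \<notin> ?A \<longrightarrow>
          \<sigma> \<in> ?\<Omega> \<and> \<sigma> \<notin> Dn \<and> bridges \<sigma> \<noteq> {} \<and> \<tau> = \<sigma> - {sb r \<sigma>})"
      proof (rule psubset.IH)
        show "?\<Omega> \<subset> \<Omega>" using \<sigma> by blast
        show "\<exists>T \<in> Up \<inter> ?\<Omega>. T - {sb r T} = \<tau>" if \<tau>: "\<tau> \<in> Dn" "\<tau> \<in> ?\<Omega>" for \<tau>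
        proof -
          \<comment> \<open>The mate \<open>T\<close> is still waiting: \<open>T = \<sigma>\<close>
            would give \<open>\<tau> = ?h\<close>, which has been dropped, and \<open>?h\<close> is
            not in \<open>Up\<close>.\<close>
          obtain T where "T \<in> Up" "T \<in> \<Omega>" "T - {sb r T} = \<tau>" using Dn[of \<tau>] \<tau> by blast
          then show ?thesis using nUp \<tau> by blast
        qed
      qed (use fin C in blast)+
      note ih1 = this[THEN conjunct1] and ih2 = this[THEN conjunct2, THEN conjunct1, rule_format]
        and ih3 = this[THEN conjunct2, THEN conjunct2, rule_format]
      have in_loop: "(\<tau>, \<tau> - {sb r \<tau>}) \<in> bm_loop r ?\<Omega> ?A" if \<tau>: "\<tau> \<in> Up \<inter> \<Omega>" for \<tau>
      proof (cases "\<tau> = \<sigma>")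
        case True
        then show ?thesis using ih1 by blast
      next
        case False
        then have "\<tau> \<in> Up \<inter> ?\<Omega>" using \<tau> nUp by blast
        then show ?thesis by (rule ih2)
      qed
      have from_loop: "\<upsilon> \<in> \<Omega> \<and> \<upsilon> \<notin> Dn \<and> bridges \<upsilon> \<noteq> {} \<and> \<tau> = \<upsilon> - {sb r \<upsilon>}"
        if "(\<upsilon>, \<tau>) \<in> bm_loop r ?\<Omega> ?A" "(\<upsilon>, \<tau>) \<notin> A" for \<upsilon> \<tau>
      proof (cases "(\<upsilon>, \<tau>) = (\<sigma>, ?h)")
        case True
        then show ?thesis using \<sigma> nDn br by blast
      next
        case False
        then have "(\<upsilon>, \<tau>) \<notin> ?A" using that(2) by blast
        show ?thesis using ih3[OF that(1) \<open>(\<upsilon>, \<tau>) \<notin> ?A\<close>] by simp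
      qed
      have "A \<subseteq> bm_loop r ?\<Omega> ?A" using ih1 by blast
      then show ?thesis unfolding hasbr[OF br]
        by (intro conjI[OF _ conjI] ballI allI impI in_loop from_loop)
    qed
  qed
qed

text \<open>This coarser description of the edges holds for every relation \<open>r\<close>; it
  gives homogeneity of the matching for any choice of rank orders.\<close>

lemma bm_loop_edge:
  assumes "finite \<Omega>" "(\<sigma>, \<tau>) \<in> bm_loop r \<Omega> A"
  shows "(\<sigma>, \<tau>) \<in> A \<or> \<sigma> \<in> \<Omega> \<and> bridges \<sigma> \<noteq> {} \<and> \<tau> = \<sigma> - {sb r \<sigma>}"
  using assms
proof (induction \<Omega> arbitrary: A rule: finite_psubset_induct)
  case (psubset \<Omega> A)
  show ?case
  proof (cases "\<Omega> = {}")
    case True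
    then show ?thesis using psubset.prems by (simp add: bm_loop_empty)
  next
    case False
    obtain \<upsilon> where \<upsilon>: "\<upsilon> \<in> \<Omega>" and "\<And>\<tau>. \<tau> \<in> \<Omega> \<Longrightarrow> card \<tau> \<le> card \<upsilon>"
      and nobr: "bridges \<upsilon> = {} \<Longrightarrow> bm_loop r \<Omega> A = bm_loop r (\<Omega> - {\<upsilon>}) A"
      and hasbr: "bridges \<upsilon> \<noteq> {} \<Longrightarrow> bm_loop r \<Omega> A =
      bm_loop r (\<Omega> - {\<upsilon>, \<upsilon> - {sb r \<upsilon>}}) (insert (\<upsilon>, \<upsilon> - {sb r \<upsilon>}) A)"
      by (rule bm_loop_step[OF psubset.hyps False, where r = r and A = A], rule that)
    have sub: "\<Omega> - {\<upsilon>} \<subset> \<Omega>" "\<Omega> - {\<upsilon>, \<upsilon> - {sb r \<upsilon>}} \<subset> \<Omega>" using \<upsilon> by blast+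
    show ?thesis
    proof (cases "bridges \<upsilon> = {}")
      case True
      then show ?thesis using psubset.IH[OF sub(1), of A] psubset.prems nobr by auto
    next
      case br: False
      then show ?thesis using psubset.IH[OF sub(2), of "insert (\<upsilon>, \<upsilon> - {sb r \<upsilon>}) A"]
          psubset.prems hasbr \<upsilon> by auto
    qed
  qed
qed

lemma gbm_matching_homogeneous:
  assumes fin: "finite G"
    and succ: "\<And>v. \<exists>\<rho>. inj_on \<rho> G \<and> succ v = rank_order G \<rho>"
    and A: "(\<sigma>, \<tau>) \<in> gbm_matching n G succ"
  shows "mlcm \<sigma> = mlcm \<tau>"
proof -
  obtain v where v: "(\<sigma>, \<tau>) \<in> bm_edges G (succ v) v"
    using A by (auto simp: gbm_matching_def)
  obtain \<rho> where \<rho>: "inj_on \<rho> G" "succ v = rank_order G \<rho>" using succ by blast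
  let ?\<Omega> = "{\<sigma>. \<sigma> \<subseteq> G \<and> mlcm \<sigma> = v \<and> card \<sigma> \<ge> 3}"
  have "(\<sigma>, \<tau>) \<in> bm_loop (succ v) ?\<Omega> {}" using v by (auto simp: bm_edges_def Let_def)
  then have *: "\<sigma> \<subseteq> G" "bridges \<sigma> \<noteq> {}" "\<tau> = \<sigma> - {sb (succ v) \<sigma>}"
    using bm_loop_edge[of ?\<Omega> \<sigma> \<tau> "succ v" "{}"] fin by auto
  have "sb (succ v) \<sigma> \<in> bridges \<sigma>"
    unfolding \<rho>(2) by (rule sb_rank_order(1)[OF *(1,2) \<rho>(1)])
  then show ?thesis unfolding *(3) by (simp add: bridges_def)
qed


section \<open>Matching by toggles\<close>

text \<open>An abstraction of arcs on a cut cycle. Squarefreeness reduces the lcm of a cell to the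
  set of covered vertices, the antichain condition excludes bridges in cells of two elements, and by
  \<open>locality\<close> the generator \<open>x\<close> helps to cover \<open>b\<close> only where
  \<open>m\<close> or \<open>a\<close> does.\<close>

locale ranked_gens =
  fixes G :: "mono set" and \<rho> :: "mono \<Rightarrow> nat"
  assumes finite_G: "finite G"
    and inj: "inj_on \<rho> G"
    and squarefree: "m \<in> G \<Longrightarrow> Poly_Mapping.lookup m i \<le> 1"
    and antichain: "m \<in> G \<Longrightarrow> m' \<in> G \<Longrightarrow> Poly_Mapping.keys m \<subseteq> Poly_Mapping.keys m' \<Longrightarrow> m = m'"
    and locality: "b \<in> G \<Longrightarrow> m \<in> G \<Longrightarrow> x \<in> G \<Longrightarrow> a \<in> G \<Longrightarrow> \<rho> b < \<rho> m \<Longrightarrow> \<rho> m < \<rho> x \<Longrightarrow> \<rho> x < \<rho> a \<Longrightarrow>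
      Poly_Mapping.keys b \<inter> Poly_Mapping.keys x \<subseteq> Poly_Mapping.keys m \<union> Poly_Mapping.keys a"
begin

section \<open>Bridges in terms of covered vertices\<close>

definition cover :: "cell \<Rightarrow> nat set" where
  "cover \<sigma> = (\<Union>m\<in>\<sigma>. Poly_Mapping.keys m)"

lemma finite_cell: "\<sigma> \<subseteq> G \<Longrightarrow> finite \<sigma>"
  using finite_G finite_subset by blast

lemma lookup_mlcm_le_1:
  assumes "\<sigma> \<subseteq> G"
  shows "Poly_Mapping.lookup (mlcm \<sigma>) i \<le> 1"
  using assms finite_cell[OF assms] squarefree by (auto simp: lookup_mlcm)

lemma mlcm_eq_iff:
  assumes "\<sigma> \<subseteq> G" "\<tau> \<subseteq> G"
  shows "mlcm \<sigma> = mlcm \<tau> \<longleftrightarrow> cover \<sigma> = cover \<tau>"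
proof
  assume "cover \<sigma> = cover \<tau>"
  then have *: "Poly_Mapping.keys (mlcm \<sigma>) = Poly_Mapping.keys (mlcm \<tau>)"
    using assms finite_cell by (simp add: cover_def keys_mlcm)
  show "mlcm \<sigma> = mlcm \<tau>"
  proof (rule poly_mapping_eqI)
    fix i
    have "(Poly_Mapping.lookup (mlcm \<sigma>) i = 0) = (Poly_Mapping.lookup (mlcm \<tau>) i = 0)"
      using * by (metis in_keys_iff)
    then show "Poly_Mapping.lookup (mlcm \<sigma>) i = Poly_Mapping.lookup (mlcm \<tau>) i"
      using lookup_mlcm_le_1[OF assms(1), of i] lookup_mlcm_le_1[OF assms(2), of i] by linarith
  qed
qed (use assms finite_cell in \<open>metis cover_def keys_mlcm\<close>)

lemma bridges_iff:
  assumes "\<sigma> \<subseteq> G"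
  shows "b \<in> bridges \<sigma> \<longleftrightarrow> b \<in> \<sigma> \<and> Poly_Mapping.keys b \<subseteq> cover (\<sigma> - {b})"
  using mlcm_eq_iff[of "\<sigma> - {b}" \<sigma>] assms by (auto simp: bridges_def cover_def)

lemma bridges_mono: "\<sigma> \<subseteq> \<tau> \<Longrightarrow> \<tau> \<subseteq> G \<Longrightarrow> bridges \<sigma> \<subseteq> bridges \<tau>"
proof
  fix b assume \<tau>: "\<sigma> \<subseteq> \<tau>" "\<tau> \<subseteq> G" and b: "b \<in> bridges \<sigma>"
  have "cover (\<sigma> - {b}) \<subseteq> cover (\<tau> - {b})" using \<tau>(1) unfolding cover_def by blast
  then show "b \<in> bridges \<tau>"
    using \<tau> b bridges_iff[of \<sigma> b] bridges_iff[of \<tau> b] by auto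
qed

text \<open>Only generators below the maximal one of the cell are toggled, so toggling preserves
  the maximal one.\<close>

definition toggle :: "cell \<Rightarrow> mono \<Rightarrow> bool" where
  "toggle \<sigma> m \<longleftrightarrow> m \<in> bridges (insert m \<sigma>) \<and> (\<forall>b \<in> bridges (insert m \<sigma>). \<rho> m \<le> \<rho> b) \<and>
     (\<exists>a\<in>\<sigma>. \<rho> m < \<rho> a) \<and> m \<in> G"

definition first_toggle :: "cell \<Rightarrow> mono \<Rightarrow> bool" where
  "first_toggle \<sigma> m \<longleftrightarrow> toggle \<sigma> m \<and> (\<forall>m'. toggle \<sigma> m' \<longrightarrow> \<rho> m \<le> \<rho> m')"

lemma first_toggle_unique: "first_toggle \<sigma> m \<Longrightarrow> first_toggle \<sigma> m' \<Longrightarrow> m = m'"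
  using inj_onD[OF inj, of m m'] by (simp add: first_toggle_def toggle_def le_antisym)

lemma ex_first_toggle: "toggle \<sigma> m \<Longrightarrow> \<exists>m'. first_toggle \<sigma> m'"
  unfolding first_toggle_def using ex_has_least_nat[of "toggle \<sigma>" m \<rho>] by blast

text \<open>Suppose that the removal enables a smaller toggle \<open>m'\<close>. For
  \<open>\<sigma>\<close> itself \<open>m'\<close> is ruled out by a still smaller bridge
  \<open>b\<close>. By \<open>locality\<close>, what \<open>b\<close> shares with \<open>m\<close>
  is covered by \<open>m'\<close> or \<open>a\<close>, so \<open>b\<close> stays a bridge after the
  removal and rules out \<open>m'\<close> there too.\<close>

lemma first_toggle_remove:
  assumes \<sigma>: "\<sigma> \<subseteq> G" "m \<in> \<sigma>" and m: "first_toggle \<sigma> m"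
  shows "first_toggle (\<sigma> - {m}) m"
proof -
  have ins: "insert m \<sigma> = \<sigma>" "insert m (\<sigma> - {m}) = \<sigma>" using \<sigma> by auto
  have tog: "toggle \<sigma> m" using m by (simp add: first_toggle_def)
  obtain a where a: "a \<in> \<sigma>" "\<rho> m < \<rho> a" using tog by (auto simp: toggle_def)
  have "toggle (\<sigma> - {m}) m"
    using tog a unfolding toggle_def ins by auto
  moreover have "\<rho> m \<le> \<rho> m'" if m': "toggle (\<sigma> - {m}) m'" for m'
  proof (rule ccontr)
    assume "\<not> \<rho> m \<le> \<rho> m'"
    then have lt: "\<rho> m' < \<rho> m" by simp
    let ?\<tau> = "insert m' (\<sigma> - {m})"
    have G: "?\<tau> \<subseteq> G" "insert m' \<sigma> \<subseteq> G" using m' \<sigma> by (auto simp: toggle_def)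
    have br: "m' \<in> bridges ?\<tau>" using m' by (simp add: toggle_def)
    have "m' \<notin> \<sigma>"
    proof
      assume "m' \<in> \<sigma>"
      then have "m' \<in> bridges \<sigma>" using br bridges_mono[of ?\<tau> \<sigma>] \<sigma> by blast
      then show False using tog lt by (auto simp: toggle_def ins)
    qed
    have "\<not> toggle \<sigma> m'" using m lt by (auto simp: first_toggle_def)
    moreover have "m' \<in> bridges (insert m' \<sigma>)"
      using br bridges_mono[of ?\<tau> "insert m' \<sigma>"] G by blast
    moreover have "\<rho> m' < \<rho> a" using lt a by simp
    ultimately obtain b where b: "b \<in> bridges (insert m' \<sigma>)" "\<rho> b < \<rho> m'"
      using a(1) G by (auto simp: toggle_def not_le)
    have bG: "b \<in> G" "b \<noteq> m'" "b \<noteq> m" "b \<noteq> a" using b lt a G bridges_subset by fastforce+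
    have bc: "Poly_Mapping.keys b \<subseteq> cover (insert m' \<sigma> - {b})" "b \<in> insert m' \<sigma>"
      using b bridges_iff[OF G(2)] by auto
    have "Poly_Mapping.keys b \<subseteq> cover (?\<tau> - {b})"
    proof
      fix c assume c: "c \<in> Poly_Mapping.keys b"
      then obtain y where y: "y \<in> insert m' \<sigma>" "y \<noteq> b" "c \<in> Poly_Mapping.keys y"
        using bc by (auto simp: cover_def)
      show "c \<in> cover (?\<tau> - {b})"
      proof (cases "y = m")
        case True
        then have "c \<in> Poly_Mapping.keys m' \<union> Poly_Mapping.keys a"
          using locality[of b m' m a] c y(3) bG b(2) lt a \<sigma> G by auto
        then show ?thesis using a bG by (auto simp: cover_def)
      qed (use y in \<open>auto simp: cover_def\<close>)
    qed
    then have "b \<in> bridges ?\<tau>" using bridges_iff[OF G(1)] bc(2) bG by auto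
    then show False using m' b(2) by (auto simp: toggle_def)
  qed
  ultimately show ?thesis by (simp add: first_toggle_def)
qed

text \<open>As \<open>m\<close> is covered by \<open>\<sigma>\<close>, inserting it does not enlarge
  the cover. A smaller toggle afterwards is therefore a bridge before as well, and the smaller cell
  has no further bridges that could prevent it.\<close>

lemma first_toggle_insert:
  assumes \<sigma>: "\<sigma> \<subseteq> G" "m \<notin> \<sigma>" and m: "first_toggle \<sigma> m"
  shows "first_toggle (insert m \<sigma>) m"
proof -
  have tog: "toggle \<sigma> m" using m by (simp add: first_toggle_def)
  have G: "insert m \<sigma> \<subseteq> G" using tog \<sigma> by (auto simp: toggle_def)
  obtain a where a: "a \<in> \<sigma>" "\<rho> m < \<rho> a" using tog by (auto simp: toggle_def)
  have cov: "Poly_Mapping.keys m \<subseteq> cover \<sigma>"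
    using tog bridges_iff[OF G] \<sigma>(2) by (auto simp: toggle_def)
  have "toggle (insert m \<sigma>) m" using tog by (auto simp: toggle_def)
  moreover have "\<rho> m \<le> \<rho> m'" if m': "toggle (insert m \<sigma>) m'" for m'
  proof (rule ccontr)
    assume "\<not> \<rho> m \<le> \<rho> m'"
    then have lt: "\<rho> m' < \<rho> m" by simp
    have G': "insert m' (insert m \<sigma>) \<subseteq> G" using m' G unfolding toggle_def by blast
    have br: "m' \<in> bridges (insert m' (insert m \<sigma>))" using m' unfolding toggle_def by blast
    have notin: "m' \<notin> insert m \<sigma>"
    proof
      assume "m' \<in> insert m \<sigma>"
      then have "m' \<in> bridges (insert m \<sigma>)" using br by (simp only: insert_absorb)
      then have "\<rho> m \<le> \<rho> m'" using tog unfolding toggle_def by blast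
      then show False using lt by simp
    qed
    then have "Poly_Mapping.keys m' \<subseteq> cover (insert m \<sigma>)"
      using br bridges_iff[OF G'] by auto
    then have "Poly_Mapping.keys m' \<subseteq> cover \<sigma>" using cov by (auto simp: cover_def)
    then have "m' \<in> bridges (insert m' \<sigma>)"
      using bridges_iff[of "insert m' \<sigma>" m'] G' notin by auto
    moreover have "\<forall>b \<in> bridges (insert m' \<sigma>). \<rho> m' \<le> \<rho> b"
      using m' bridges_mono[of "insert m' \<sigma>" "insert m' (insert m \<sigma>)"] G'
      unfolding toggle_def by blast
    moreover have "\<rho> m' < \<rho> a" "m' \<in> G" using a lt G' by auto
    ultimately have "toggle \<sigma> m'" using a(1) unfolding toggle_def by blast
    then show False using m lt by (auto simp: first_toggle_def)
  qed
  ultimately show ?thesis by (simp add: first_toggle_def)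
qed

text \<open>If some bridge were below \<open>a\<close>, the smallest bridge would be a toggle that
  is already in the cell. So at most the last generator of a toggle-free cell is a bridge.\<close>

lemma bridge_of_toggle_free:
  assumes \<sigma>: "\<sigma> \<subseteq> G" "\<And>m. \<not> toggle \<sigma> m" and b: "b \<in> bridges \<sigma>" and a: "a \<in> \<sigma>"
  shows "\<rho> a \<le> \<rho> b"
proof (rule ccontr)
  assume *: "\<not> \<rho> a \<le> \<rho> b"
  obtain c where c: "c \<in> bridges \<sigma>" "\<And>b. b \<in> bridges \<sigma> \<Longrightarrow> \<rho> c \<le> \<rho> b"
    using b ex_has_least_nat[of "\<lambda>m. m \<in> bridges \<sigma>" b \<rho>] by blast
  have "c \<in> \<sigma>" using c(1) bridges_subset by blast
  moreover have "\<rho> c < \<rho> a" using * c(2)[OF b] by simp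
  ultimately have "toggle \<sigma> c"
    using c a \<sigma>(1) by (auto simp: toggle_def insert_absorb)
  then show False using \<sigma>(2) by blast
qed

text \<open>Here \<open>m\<close> is the first difference. It is covered by
  \<open>\<sigma>'\<close>, so only a smaller bridge \<open>b\<close> can keep it from being a
  toggle there. This \<open>b\<close> also lies in \<open>\<sigma>\<close>, and whatever covers it
  in \<open>insert m \<sigma>'\<close> is common to both cells or can be replaced by
  \<open>m\<close> and \<open>a\<close>. Hence \<open>b\<close> is a bridge of
  \<open>\<sigma>\<close> below the last generator.\<close>

lemma toggle_free_no_difference:
  assumes \<sigma>: "\<sigma> \<subseteq> G" "\<And>m. \<not> toggle \<sigma> m" and \<sigma>': "\<sigma>' \<subseteq> G" "\<And>m. \<not> toggle \<sigma>' m"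
    and eq: "cover \<sigma> = cover \<sigma>'"
    and a: "a \<in> \<sigma>" "a \<in> \<sigma>'" "\<And>s. s \<in> \<sigma>' \<Longrightarrow> \<rho> s \<le> \<rho> a" "\<And>s. s \<in> \<sigma> \<Longrightarrow> \<rho> s \<le> \<rho> a"
    and m: "m \<in> \<sigma>" "m \<notin> \<sigma>'" and agree: "\<And>y. y \<in> G \<Longrightarrow> \<rho> y < \<rho> m \<Longrightarrow> y \<in> \<sigma> \<longleftrightarrow> y \<in> \<sigma>'"
  shows False
proof -
  have "\<rho> m \<noteq> \<rho> a" using inj m a \<sigma> by (metis inj_onD subsetD)
  then have ma: "\<rho> m < \<rho> a" using a(4)[OF m(1)] by simp
  have G: "insert m \<sigma>' \<subseteq> G" using m \<sigma> \<sigma>' by auto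
  have "Poly_Mapping.keys m \<subseteq> cover \<sigma>'" using eq m by (auto simp: cover_def)
  then have "m \<in> bridges (insert m \<sigma>')" using bridges_iff[OF G] m by auto
  then obtain b where b: "b \<in> bridges (insert m \<sigma>')" "\<rho> b < \<rho> m"
    using \<sigma>'(2)[of m] ma a(2) G by (auto simp: toggle_def not_le)
  have bc: "b \<in> insert m \<sigma>'" "Poly_Mapping.keys b \<subseteq> cover (insert m \<sigma>' - {b})"
    using b(1) bridges_iff[OF G] by auto
  have bG: "b \<in> G" "b \<noteq> m" "b \<noteq> a" using bc(1) G b(2) ma by auto
  have b\<sigma>: "b \<in> \<sigma>" using agree[OF bG(1) b(2)] bc(1) bG by auto
  have "Poly_Mapping.keys b \<subseteq> cover (\<sigma> - {b})"
  proof
    fix c assume c: "c \<in> Poly_Mapping.keys b"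
    then obtain y where y: "y \<in> insert m \<sigma>'" "y \<noteq> b" "c \<in> Poly_Mapping.keys y"
      using bc by (auto simp: cover_def)
    have yG: "y \<in> G" using y(1) G by blast
    consider "\<rho> y < \<rho> m" | "y = m" | "y = a" | "\<rho> m < \<rho> y" "\<rho> y < \<rho> a"
    proof -
      have "\<rho> y = \<rho> m \<Longrightarrow> y = m" "\<rho> y = \<rho> a \<Longrightarrow> y = a"
        using inj yG m a \<sigma> by (meson inj_onD subsetD)+
      moreover have "\<rho> y \<le> \<rho> a" using y(1) a(3) ma by auto
      ultimately show ?thesis using that by linarith
    qed
    then show "c \<in> cover (\<sigma> - {b})"
    proof cases
      case 1
      then have "y \<in> \<sigma>" using agree[OF yG 1] y(1) by auto
      then show ?thesis using y by (auto simp: cover_def)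
    next
      case 4
      then have "c \<in> Poly_Mapping.keys m \<union> Poly_Mapping.keys a"
        using locality[of b m y a] bG yG c y(3) b(2) m a \<sigma> by auto
      then show ?thesis using m a bG by (auto simp: cover_def)
    qed (use y m a in \<open>auto simp: cover_def\<close>)
  qed
  then have "b \<in> bridges \<sigma>" using bridges_iff[OF \<sigma>(1)] b\<sigma> by auto
  then show False using bridge_of_toggle_free[OF \<sigma> _ a(1)] b(2) ma by fastforce
qed

lemma toggle_free_unique:
  assumes \<sigma>: "\<sigma> \<subseteq> G" "\<And>m. \<not> toggle \<sigma> m" and \<sigma>': "\<sigma>' \<subseteq> G" "\<And>m. \<not> toggle \<sigma>' m"
    and eq: "mlcm \<sigma> = mlcm \<sigma>'"
    and a: "a \<in> \<sigma>" "a \<in> \<sigma>'" "\<And>s. s \<in> \<sigma> \<Longrightarrow> \<rho> s \<le> \<rho> a" "\<And>s. s \<in> \<sigma>' \<Longrightarrow> \<rho> s \<le> \<rho> a"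
  shows "\<sigma> = \<sigma>'"
proof (rule ccontr)
  assume "\<sigma> \<noteq> \<sigma>'"
  then have "\<exists>m. m \<in> (\<sigma> - \<sigma>') \<union> (\<sigma>' - \<sigma>)" by blast
  then obtain m where m: "m \<in> (\<sigma> - \<sigma>') \<union> (\<sigma>' - \<sigma>)"
    "\<And>y. y \<in> (\<sigma> - \<sigma>') \<union> (\<sigma>' - \<sigma>) \<Longrightarrow> \<rho> m \<le> \<rho> y"
    using ex_has_least_nat[of "\<lambda>m. m \<in> (\<sigma> - \<sigma>') \<union> (\<sigma>' - \<sigma>)" _ \<rho>] by blast
  have agree: "y \<in> \<sigma> \<longleftrightarrow> y \<in> \<sigma>'" if "\<rho> y < \<rho> m" for y using m(2)[of y] that by auto
  have cov: "cover \<sigma> = cover \<sigma>'" using eq mlcm_eq_iff \<sigma> \<sigma>' by blast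
  show False
  proof (cases "m \<in> \<sigma>")
    case True
    then show False
      using toggle_free_no_difference[OF \<sigma> \<sigma>' cov a(1,2,4,3), of m] m(1) agree by blast
  next
    case False
    then show False
      using toggle_free_no_difference[OF \<sigma>' \<sigma> cov[symmetric] a(2,1,3,4), of m] m(1) agree by blast
  qed
qed

section \<open>The two sides of the toggle matching\<close>

definition Up :: "mono \<Rightarrow> cell set" where
  "Up v = {\<sigma>. \<sigma> \<subseteq> G \<and> mlcm \<sigma> = v \<and> (\<exists>m\<in>\<sigma>. first_toggle \<sigma> m)}"

definition Dn :: "mono \<Rightarrow> cell set" where
  "Dn v = {\<sigma>. \<sigma> \<subseteq> G \<and> mlcm \<sigma> = v \<and> (\<exists>m. m \<notin> \<sigma> \<and> first_toggle \<sigma> m)}"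

lemma first_toggle_sb:
  assumes "\<sigma> \<subseteq> G" "m \<in> \<sigma>" "first_toggle \<sigma> m"
  shows "sb (rank_order G \<rho>) \<sigma> = m" "m \<in> bridges \<sigma>"
  using assms inj
  by (auto simp: first_toggle_def toggle_def insert_absorb intro!: sb_rank_order_eqI)

lemma Up_remove:
  assumes "\<sigma> \<in> Up v"
  shows "bridges \<sigma> \<noteq> {} \<and> sb (rank_order G \<rho>) \<sigma> \<in> \<sigma> \<and> \<sigma> - {sb (rank_order G \<rho>) \<sigma>} \<in> Dn v"
proof -
  obtain m where m: "\<sigma> \<subseteq> G" "m \<in> \<sigma>" "first_toggle \<sigma> m" "mlcm \<sigma> = v"
    using assms by (auto simp: Up_def)
  have "mlcm (\<sigma> - {m}) = v" using first_toggle_sb(2)[OF m(1-3)] m(4) by (simp add: bridges_def)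
  then show ?thesis
    using m first_toggle_sb[OF m(1-3)] first_toggle_remove[OF m(1-3)] by (auto simp: Dn_def)
qed

lemma Dn_insert:
  assumes "\<tau> \<in> Dn v"
  shows "\<exists>\<sigma> \<in> Up v. \<sigma> - {sb (rank_order G \<rho>) \<sigma>} = \<tau>"
proof -
  obtain m where m: "\<tau> \<subseteq> G" "m \<notin> \<tau>" "first_toggle \<tau> m" "mlcm \<tau> = v"
    using assms by (auto simp: Dn_def)
  let ?\<sigma> = "insert m \<tau>"
  have G: "?\<sigma> \<subseteq> G" using m by (auto simp: first_toggle_def toggle_def)
  have ft: "first_toggle ?\<sigma> m" by (rule first_toggle_insert[OF m(1-3)])
  have "mlcm ?\<sigma> = v" using first_toggle_sb(2)[OF G _ ft] m by (auto simp: bridges_def)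
  then have "?\<sigma> \<in> Up v" using G ft by (auto simp: Up_def)
  moreover have "?\<sigma> - {sb (rank_order G \<rho>) ?\<sigma>} = \<tau>"
    using first_toggle_sb(1)[OF G _ ft] m(2) by auto
  ultimately show ?thesis by blast
qed

lemma Up_Dn_disjoint: "Up v \<inter> Dn v = {}"
  using first_toggle_unique by (auto simp: Up_def Dn_def)

text \<open>The first toggle stays the first toggle after its removal, so it can be read off from
  the common target.\<close>

lemma Up_inj:
  assumes "\<sigma> \<in> Up v" "\<sigma>' \<in> Up v"
    and "\<sigma> - {sb (rank_order G \<rho>) \<sigma>} = \<sigma>' - {sb (rank_order G \<rho>) \<sigma>'}"
  shows "\<sigma> = \<sigma>'"
proof -
  obtain m where m: "\<sigma> \<subseteq> G" "m \<in> \<sigma>" "first_toggle \<sigma> m" using assms(1) by (auto simp: Up_def)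
  obtain m' where m': "\<sigma>' \<subseteq> G" "m' \<in> \<sigma>'" "first_toggle \<sigma>' m'" using assms(2) by (auto simp: Up_def)
  have "\<sigma> - {m} = \<sigma>' - {m'}"
    using assms(3) first_toggle_sb(1)[OF m] first_toggle_sb(1)[OF m'] by simp
  moreover from this have "m = m'"
    using first_toggle_unique first_toggle_remove[OF m] first_toggle_remove[OF m'] by metis
  ultimately show ?thesis using m(2) m'(2) by blast
qed

text \<open>The algorithm starts only from cells with at least three elements; this puts all of
  \<open>Up\<close> within its reach. In a cell of two elements a bridge would divide the other
  generator.\<close>

lemma Up_card:
  assumes "\<sigma> \<in> Up v"
  shows "card \<sigma> \<ge> 3"
proof (rule ccontr)
  assume small: "\<not> card \<sigma> \<ge> 3"
  obtain m where m: "\<sigma> \<subseteq> G" "m \<in> \<sigma>" "first_toggle \<sigma> m" using assms by (auto simp: Up_def)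
  obtain a where a: "a \<in> \<sigma>" "\<rho> m < \<rho> a" using m(3) by (auto simp: first_toggle_def toggle_def)
  have "m \<noteq> a" using a by auto
  then have "{m, a} = \<sigma>"
    using small m a finite_cell by (intro card_seteq) auto
  then have "\<sigma> - {m} = {a}" using a by auto
  moreover have "Poly_Mapping.keys m \<subseteq> cover (\<sigma> - {m})"
    using first_toggle_sb(2)[OF m] bridges_iff[OF m(1)] by blast
  ultimately have "Poly_Mapping.keys m \<subseteq> Poly_Mapping.keys a" by (simp add: cover_def)
  then show False using antichain[of m a] m a by auto
qed

text \<open>A toggle puts \<open>\<sigma>\<close> into \<open>Up\<close> or \<open>Dn\<close>, so it
  suffices that the edge between mates is produced by the loop and survives the clean-up.\<close>

lemma critical_toggle_free:
  assumes \<sigma>: "\<sigma> \<in> critical G A k" and A: "bm_edges G (rank_order G \<rho>) (mlcm \<sigma>) \<subseteq> A"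
  shows "\<not> toggle \<sigma> m"
proof
  assume "toggle \<sigma> m"
  then obtain m where ft: "first_toggle \<sigma> m" using ex_first_toggle by blast
  define v where "v = mlcm \<sigma>"
  let ?r = "rank_order G \<rho>"
  let ?h = "\<lambda>\<sigma>. \<sigma> - {sb ?r \<sigma>}"
  let ?\<Omega> = "{\<sigma>. \<sigma> \<subseteq> G \<and> mlcm \<sigma> = v \<and> card \<sigma> \<ge> 3}"
  let ?L = "bm_loop ?r ?\<Omega> {}"
  have free: "\<not> toggle \<tau> m" if "\<tau> \<subseteq> G" "mlcm \<tau> = v" "\<tau> \<notin> Up v" "\<tau> \<notin> Dn v" for \<tau> m
    using that ex_first_toggle[of \<tau> m] by (auto simp: Up_def Dn_def)
  have "{} \<subseteq> ?L \<and> (\<forall>\<sigma> \<in> Up v \<inter> ?\<Omega>. (\<sigma>, ?h \<sigma>) \<in> ?L) \<and>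
    (\<forall>\<sigma> \<tau>. (\<sigma>, \<tau>) \<in> ?L \<longrightarrow> (\<sigma>, \<tau>) \<notin> {} \<longrightarrow>
       \<sigma> \<in> ?\<Omega> \<and> \<sigma> \<notin> Dn v \<and> bridges \<sigma> \<noteq> {} \<and> \<tau> = ?h \<sigma>)"
  proof (rule bm_loop_matching)
    show "finite ?\<Omega>" using finite_G by simp
    show "finite \<sigma>" if "\<sigma> \<in> ?\<Omega>" for \<sigma> using that finite_cell by blast
    show "bridges \<sigma> \<noteq> {} \<and> sb ?r \<sigma> \<in> \<sigma> \<and> ?h \<sigma> \<in> Dn v" if "\<sigma> \<in> Up v" for \<sigma>
      using that by (rule Up_remove)
    show "\<exists>\<sigma> \<in> Up v \<inter> ?\<Omega>. ?h \<sigma> = \<tau>" if \<tau>: "\<tau> \<in> Dn v" "\<tau> \<in> ?\<Omega>" for \<tau>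
    proof -
      obtain \<sigma> where "\<sigma> \<in> Up v" "?h \<sigma> = \<tau>" using Dn_insert \<tau> by blast
      then show ?thesis using Up_card by (auto simp: Up_def)
    qed
    show "Up v \<inter> Dn v = {}" by (rule Up_Dn_disjoint)
    \<comment> \<open>A toggle inside the facet would be a bridge of the toggle-free cell
      \<open>\<sigma>\<close> below another of its elements.\<close>
    show "?h \<sigma> \<notin> Up v" if "\<sigma> \<in> ?\<Omega>" "\<sigma> \<notin> Up v" "\<sigma> \<notin> Dn v" "bridges \<sigma> \<noteq> {}" for \<sigma>
    proof
      assume "?h \<sigma> \<in> Up v"
      then obtain m where m: "m \<in> ?h \<sigma>" "first_toggle (?h \<sigma>) m" by (auto simp: Up_def)
      then obtain a where a: "a \<in> ?h \<sigma>" "\<rho> m < \<rho> a" by (auto simp: first_toggle_def toggle_def)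
      have "m \<in> bridges (?h \<sigma>)" using first_toggle_sb(2)[OF _ m] that(1) by blast
      then have "m \<in> bridges \<sigma>" using bridges_mono[of "?h \<sigma>" \<sigma>] that(1) by blast
      then have "\<rho> a \<le> \<rho> m" using bridge_of_toggle_free[of \<sigma> m a] free that a(1) by blast
      then show False using a(2) by simp
    qed
  qed
  note L = this[THEN conjunct2, THEN conjunct1, rule_format]
    this[THEN conjunct2, THEN conjunct2, rule_format]
  have L_Up: "(T, ?h T) \<in> ?L" if T: "T \<in> Up v" for T
    using L(1)[of T] T Up_card[OF T] by (simp add: Up_def)
  have L_edge: "T \<subseteq> G" "mlcm T = v" "T \<notin> Dn v" "bridges T \<noteq> {}" "\<tau> = ?h T"
    if "(T, \<tau>) \<in> ?L" for T \<tau>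
    using L(2)[OF that] by simp_all
  have edge: "(T, ?h T) \<in> bm_edges G ?r v" if T: "T \<in> Up v" for T
  proof -
    \<comment> \<open>A competitor for the same target is not in \<open>Up\<close>, as mates are
      unique. It is thus toggle-free, and its smallest bridge ranks at least as high as
      \<open>a\<close>, hence above the toggle \<open>m\<close>.\<close>
    have False if \<upsilon>: "(\<upsilon>, ?h T) \<in> ?L" "\<upsilon> \<noteq> T" "(sb ?r T, sb ?r \<upsilon>) \<in> ?r" for \<upsilon>
    proof -
      have e: "\<upsilon> \<subseteq> G" "mlcm \<upsilon> = v" "\<upsilon> \<notin> Dn v" "bridges \<upsilon> \<noteq> {}" "?h T = ?h \<upsilon>"
        by (rule L_edge[OF \<upsilon>(1)])+
      then have "\<upsilon> \<notin> Up v" using Up_inj[OF T] \<upsilon>(2) by blast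
      obtain m where m: "T \<subseteq> G" "m \<in> T" "first_toggle T m" using T by (auto simp: Up_def)
      obtain a where a: "a \<in> T" "\<rho> m < \<rho> a" using m(3) by (auto simp: first_toggle_def toggle_def)
      have sbT: "sb ?r T = m" by (rule first_toggle_sb(1)[OF m])
      have "a \<in> ?h T" using a sbT by auto
      then have "a \<in> \<upsilon>" unfolding e(5) by simp
      moreover have "sb ?r \<upsilon> \<in> bridges \<upsilon>" by (rule sb_rank_order(1)[OF e(1,4) inj])
      ultimately have "\<rho> a \<le> \<rho> (sb ?r \<upsilon>)"
        using e(1) free[OF e(1,2) \<open>\<upsilon> \<notin> Up v\<close> e(3)] by (intro bridge_of_toggle_free)
      then show False using \<upsilon>(3) a(2) sbT by (simp add: rank_order_def)
    qed
    then have "\<not> (\<exists>\<upsilon>. (\<upsilon>, ?h T) \<in> ?L \<and> \<upsilon> \<noteq> T \<and> (sb ?r T, sb ?r \<upsilon>) \<in> ?r)" by blast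
    then show ?thesis using L_Up[OF T] by (simp add: bm_edges_def Let_def)
  qed
  have "\<sigma> \<in> Up v \<or> \<sigma> \<in> Dn v"
    using \<sigma> ft by (auto simp: Up_def Dn_def critical_def v_def)
  then have "\<exists>T. (\<sigma>, T) \<in> bm_edges G ?r v \<or> (T, \<sigma>) \<in> bm_edges G ?r v"
    using edge Dn_insert by metis
  then show False using \<sigma> A by (auto simp: critical_def v_def)
qed

end


section \<open>Toggle-free cells covering the whole cycle\<close>

text \<open>The disjunct \<open>e + n < r + p\<close> is the part of the path beyond the
  cut.\<close>

definition cyclic_arc :: "nat \<Rightarrow> nat \<Rightarrow> nat \<Rightarrow> nat set" where
  "cyclic_arc n p r = {e. e < n \<and> (r \<le> e \<and> e < r + p \<or> e + n < r + p)}"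

text \<open>Generators are replaced by their starting positions. The last assumption spells out the
  absence of toggles: whenever \<open>m\<close> would be a bridge, so is something smaller.\<close>

locale toggle_free_cycle =
  fixes n p a :: nat and X :: "nat set"
  assumes p_less: "p < n"
    and X_less: "X \<subseteq> {..<n}"
    and covered: "e < n \<Longrightarrow> \<exists>r\<in>X. e \<in> cyclic_arc n p r"
    and a_mem: "a \<in> X" and a_max: "r \<in> X \<Longrightarrow> r \<le> a"
    and toggle_free: "m < a \<Longrightarrow> cyclic_arc n p m \<subseteq> (\<Union>r\<in>X - {m}. cyclic_arc n p r) \<Longrightarrow>
      \<exists>b\<in>insert m X. b < m \<and> cyclic_arc n p b \<subseteq> (\<Union>r\<in>insert m X - {b}. cyclic_arc n p r)"
begin

lemma a_less: "a < n"
  using a_mem X_less by auto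

text \<open>The arc covering the last position \<open>n - 1\<close> reaches the cut, and
  \<open>a\<close> starts no earlier than it.\<close>

lemma n_le: "n \<le> a + p"
proof -
  obtain r where "r \<in> X" "n - 1 \<in> cyclic_arc n p r" using covered[of "n - 1"] p_less by auto
  then show ?thesis using a_max[of r] a_less by (auto simp: cyclic_arc_def)
qed

text \<open>Each bridge below \<open>a\<close> yields a smaller one, an infinite descent. So every
  element but the last has a private position \<open>e\<close>.\<close>

lemma no_bridge:
  assumes "b \<in> X" "b < a"
  obtains e where "e \<in> cyclic_arc n p b" "\<And>r. r \<in> X \<Longrightarrow> r \<noteq> b \<Longrightarrow> e \<notin> cyclic_arc n p r"
proof -
  have "\<not> cyclic_arc n p b \<subseteq> (\<Union>r\<in>X - {b}. cyclic_arc n p r)" using assms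
  proof (induction b rule: less_induct)
    case (less b)
    show ?case
    proof
      assume "cyclic_arc n p b \<subseteq> (\<Union>r\<in>X - {b}. cyclic_arc n p r)"
      then obtain c where "c \<in> X" "c < b" "cyclic_arc n p c \<subseteq> (\<Union>r\<in>X - {c}. cyclic_arc n p r)"
        using toggle_free[of b] less.prems by (auto simp: insert_absorb)
      then show False using less.IH[of c] less.prems by auto
    qed
  qed
  then show ?thesis using that by blast
qed

lemma gap_creates_bridge:
  assumes "m < a" "m \<notin> X"
  obtains b where "b \<in> X" "b < m" "cyclic_arc n p b \<subseteq> (\<Union>r\<in>insert m X - {b}. cyclic_arc n p r)"
proof -
  have "cyclic_arc n p m \<subseteq> (\<Union>r\<in>X - {m}. cyclic_arc n p r)"
    using covered assms(2) by (fastforce simp: cyclic_arc_def)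
  then show ?thesis using toggle_free[OF assms(1)] that by blast
qed

lemma a_pos: "0 < a"
  using n_le p_less by simp

lemma zero_mem: "0 \<in> X"
proof (rule ccontr)
  assume "0 \<notin> X"
  then show False using gap_creates_bridge[OF a_pos] by blast
qed

text \<open>The next two lemmas say that every other element of a toggle-free cell is exactly
  \<open>p + 1\<close> further on; here the predecessor of \<open>0\<close> is \<open>a - n\<close>.\<close>

lemma second_after_last:
  shows "\<And>y. y \<in> X \<Longrightarrow> 0 < y \<Longrightarrow> p + 1 + a \<le> y + n" and "p + 1 + a - n \<in> X"
proof -
  show E: "p + 1 + a \<le> y + n" if y: "y \<in> X" "0 < y" for y
  proof (rule ccontr)
    assume *: "\<not> p + 1 + a \<le> y + n"
    obtain e where e: "e \<in> cyclic_arc n p 0" "\<And>r. r \<in> X \<Longrightarrow> r \<noteq> 0 \<Longrightarrow> e \<notin> cyclic_arc n p r"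
      using no_bridge[OF zero_mem a_pos] by blast
    \<comment> \<open>The arc at \<open>a\<close> fills the positions below
      \<open>a + p - n\<close>, and \<open>y\<close> starts no later than there; together they would
      cover the arc at \<open>0\<close>.\<close>
    have "e \<notin> cyclic_arc n p a" "e \<notin> cyclic_arc n p y" using e(2) a_mem a_pos y by auto
    then show False using e(1) * p_less by (auto simp: cyclic_arc_def)
  qed
  show "p + 1 + a - n \<in> X"
  proof (rule ccontr)
    let ?m = "p + 1 + a - n"
    assume m: "?m \<notin> X"
    have "?m \<noteq> a" using m a_mem by auto
    then have "?m < a" using p_less by simp
    then obtain b where b: "b \<in> X" "b < ?m"
      and bc: "cyclic_arc n p b \<subseteq> (\<Union>r\<in>insert ?m X - {b}. cyclic_arc n p r)"
      using gap_creates_bridge[OF _ m] by blast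
    have b0: "b = 0" using E[of b] b by (auto simp: less_diff_conv)
    \<comment> \<open>\<open>p + a - n\<close> is the first position past the arc at
      \<open>a\<close>, and \<open>?m\<close> starts one further on, so only the arc at
      \<open>0\<close> reaches it.\<close>
    have "p + a - n < p" using n_le a_less by linarith
    then have "p + a - n \<in> cyclic_arc n p b"
      unfolding b0 using p_less by (simp add: cyclic_arc_def)
    then obtain y where y: "y \<in> insert ?m X" "y \<noteq> 0" "p + a - n \<in> cyclic_arc n p y"
      using bc b0 by blast
    show False
    proof (cases "y = ?m")
      case True
      then show False using y(3) n_le a_less p_less by (auto simp: cyclic_arc_def)
    next
      case False
      then have "y \<in> X" using y(1) by simp
      then show False using E[of y] y(2,3) a_max[of y] n_le by (auto simp: cyclic_arc_def)
    qed
  qed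
qed

lemma second_after:
  assumes s: "s \<in> X" and t: "t \<in> X" "s < t" "t < a" and consec: "\<And>y. y \<in> X \<Longrightarrow> s < y \<Longrightarrow> t \<le> y"
  shows "\<And>y. y \<in> X \<Longrightarrow> t < y \<Longrightarrow> s + p + 1 \<le> y" and "s + p + 1 \<in> X"
proof -
  show E: "s + p + 1 \<le> y" if y: "y \<in> X" "t < y" for y
  proof (rule ccontr)
    assume *: "\<not> s + p + 1 \<le> y"
    obtain e where e: "e \<in> cyclic_arc n p t" "\<And>r. r \<in> X \<Longrightarrow> r \<noteq> t \<Longrightarrow> e \<notin> cyclic_arc n p r"
      using no_bridge[OF t(1,3)] by blast
    have "e \<notin> cyclic_arc n p s" "e \<notin> cyclic_arc n p y" using e(2) s t y by auto
    then show False using e(1) * t y by (auto simp: cyclic_arc_def)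
  qed
  show "s + p + 1 \<in> X"
  proof (rule ccontr)
    let ?m = "s + p + 1"
    assume m: "?m \<notin> X"
    have "?m \<noteq> a" using m a_mem by auto
    then have ma: "?m < a" using E[OF a_mem t(3)] by simp
    \<comment> \<open>Position \<open>s + p\<close> lies just past the arc at \<open>s\<close>, so
      some element after \<open>s\<close> starts no later than there.\<close>
    have tm: "t \<le> s + p"
    proof -
      obtain y where y: "y \<in> X" "s + p \<in> cyclic_arc n p y"
        using covered[of "s + p"] ma a_less by auto
      have "y < n" using y(1) X_less by auto
      then show ?thesis using y(2) consec[OF y(1)] by (auto simp: cyclic_arc_def)
    qed
    obtain b where b: "b \<in> X" "b < ?m"
      and bc: "cyclic_arc n p b \<subseteq> (\<Union>r\<in>insert ?m X - {b}. cyclic_arc n p r)"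
      using gap_creates_bridge[OF ma m] by blast
    obtain e where e: "e \<in> cyclic_arc n p b" "\<And>r. r \<in> X \<Longrightarrow> r \<noteq> b \<Longrightarrow> e \<notin> cyclic_arc n p r"
      using no_bridge[OF b(1)] b(2) ma by (metis less_trans)
    \<comment> \<open>Only the new arc can cover the private position of \<open>b\<close>, and not
      by its wrapped part, which lies in the arc at \<open>a\<close>. For \<open>b < t\<close>, the
      arc at \<open>t\<close> would contain this position too.\<close>
    have em: "e \<in> cyclic_arc n p ?m" using bc e by blast
    have "e \<notin> cyclic_arc n p a" using e(2)[OF a_mem] b(2) ma by simp
    then have "?m \<le> e" "e < b + p"
      using em e(1) ma p_less by (auto simp: cyclic_arc_def)
    moreover have "e < n" using em by (simp add: cyclic_arc_def)
    ultimately have "e \<in> cyclic_arc n p t" if "b < t"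
      using that tm by (simp add: cyclic_arc_def)
    then have "\<not> b < t" using e(2)[OF t(1)] by blast
    then have bt: "b = t" using E[OF b(1)] b(2) by linarith
    \<comment> \<open>The arc at \<open>s\<close> ends just before \<open>s + p\<close> and the one
      at \<open>?m\<close> begins just after it, so \<open>t\<close> is alone in covering
      it.\<close>
    have "s + p \<in> cyclic_arc n p t" using tm t(2) ma a_less by (simp add: cyclic_arc_def)
    then obtain y where y: "y \<in> insert ?m X" "y \<noteq> t" "s + p \<in> cyclic_arc n p y"
      using bc bt by blast
    show False
    proof (cases "y = ?m")
      case True
      then show False using y(3) p_less by (auto simp: cyclic_arc_def)
    next
      case False
      then have yX: "y \<in> X" using y(1) by simp
      then have "y < n" using X_less by auto
      then show False using E[OF yX] consec[OF yX] y(2,3) by (auto simp: cyclic_arc_def)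
    qed
  qed
qed

text \<open>The progressions starting at \<open>0\<close> and at its successor
  \<open>p + 1 + a - n\<close> interleave, so each stretch of length \<open>p + 1\<close> adds two
  elements. The successor is carried along so that \<open>second_after\<close> can be applied twice
  per step.\<close>

lemma cell_prefix:
  assumes "j * (p + 1) \<le> a"
  shows "j * (p + 1) \<in> X \<and> card (X \<inter> {..j * (p + 1)}) = 2 * j + 1 \<and>
    (j * (p + 1) < a \<longrightarrow> j * (p + 1) + p + 1 + a - n \<in> X \<and>
      (\<forall>y\<in>X. j * (p + 1) < y \<longrightarrow> j * (p + 1) + p + 1 + a - n \<le> y))"
  using assms
proof (induction j)
  case 0
  have "X \<inter> {..0} = {0}" using zero_mem by auto
  then show ?case using zero_mem second_after_last by fastforce
next
  case (Suc j)
  let ?T = "j * (p + 1)" and ?t = "j * (p + 1) + p + 1 + a - n"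
  have S: "Suc j * (p + 1) = ?T + p + 1" by simp
  have le: "?T + p + 1 \<le> a" using Suc.prems by simp
  have ih: "?T \<in> X" "card (X \<inter> {..?T}) = 2 * j + 1" "?t \<in> X"
    "\<And>y. y \<in> X \<Longrightarrow> ?T < y \<Longrightarrow> ?t \<le> y"
    using Suc.IH le by auto
  have Tt: "?T < ?t" "?t < a" "?t < ?T + p + 1" using n_le a_less le by auto
  note next1 = second_after[OF ih(1,3) Tt(1,2) ih(4)]
  have next2: "?T + p + 1 < a \<Longrightarrow> ?t + p + 1 \<in> X"
    "\<And>y. ?T + p + 1 < a \<Longrightarrow> y \<in> X \<Longrightarrow> ?T + p + 1 < y \<Longrightarrow> ?t + p + 1 \<le> y"
    using second_after[OF ih(3) next1(2) Tt(3) _ next1(1)] by auto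
  have t': "?T + p + 1 + p + 1 + a - n = ?t + p + 1" using n_le by simp
  have "X \<inter> {..?T + p + 1} = insert (?T + p + 1) (insert ?t (X \<inter> {..?T}))"
  proof (intro equalityI subsetI)
    fix y assume y: "y \<in> X \<inter> {..?T + p + 1}"
    then have "y \<le> ?T \<or> y = ?t \<or> y = ?T + p + 1"
      using ih(4)[of y] next1(1)[of y] by (cases "y \<le> ?T"; cases "y = ?t") auto
    then show "y \<in> insert (?T + p + 1) (insert ?t (X \<inter> {..?T}))" using y by auto
  qed (use ih(3) next1(2) Tt in auto)
  moreover have "?t \<notin> X \<inter> {..?T}" "?T + p + 1 \<notin> insert ?t (X \<inter> {..?T})"
    using Tt by auto
  ultimately have "card (X \<inter> {..?T + p + 1}) = Suc (Suc (card (X \<inter> {..?T})))"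
    by (simp add: card_insert_disjoint)
  then have "card (X \<inter> {..?T + p + 1}) = 2 * Suc j + 1" using ih(2) by simp
  then show ?case unfolding S t' using next1(2) next2 by blast
qed

text \<open>If \<open>a\<close> is a multiple of \<open>p + 1\<close>, the prefix is all of
  \<open>X\<close>, and \<open>n\<close> lies strictly between \<open>a\<close> and the next
  multiple. Otherwise the successor of the last multiple must be \<open>a\<close>, which forces
  \<open>n = (j + 1) * (p + 1)\<close>.\<close>

theorem card_X:
  "card X = (if (p + 1) dvd n then 2 * (n div (p + 1)) else 2 * (n div (p + 1)) + 1)"
proof -
  define j where "j = a div (p + 1)"
  let ?T = "j * (p + 1)" and ?t = "j * (p + 1) + p + 1 + a - n"
  have T: "?T \<le> a" "a < ?T + p + 1"
    unfolding j_def using div_mult_mod_eq[of a "p + 1"] mod_less_divisor[of "p + 1" a] by linarith+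
  note st = cell_prefix[OF T(1)]
  show ?thesis
  proof (cases "?T = a")
    case True
    have "X \<inter> {..?T} = X" using a_max True by auto
    then have "card X = 2 * j + 1" using st by simp
    moreover have "n div (p + 1) = j"
      by (rule div_nat_eqI) (use True a_less n_le in \<open>auto simp: algebra_simps\<close>)
    moreover have "\<not> (p + 1) dvd n"
      using calculation(2) True a_less by (metis dvd_div_mult_self nat_neq_iff)
    ultimately show ?thesis by simp
  next
    case False
    then have lt: "?T < a" using T(1) by simp
    then have t: "?t \<in> X" "\<And>y. y \<in> X \<Longrightarrow> ?T < y \<Longrightarrow> ?t \<le> y" using st by auto
    have Tt: "?T < ?t" using n_le by simp
    \<comment> \<open>Otherwise the first progression would go on to \<open>?T + p + 1\<close>,
      beyond \<open>a\<close>.\<close>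
    have "\<not> ?t < a"
    proof
      assume "?t < a"
      then have "?T + p + 1 \<in> X" using second_after(2)[OF _ t(1) Tt _ t(2)] st by blast
      then show False using a_max T(2) by fastforce
    qed
    then have ta: "?t = a" using a_max[OF t(1)] by simp
    have "X = insert a (X \<inter> {..?T})"
    proof (intro equalityI subsetI)
      fix y assume y: "y \<in> X"
      then have "y \<le> ?T \<or> y = a" using t(2)[OF y] ta a_max[OF y] by linarith
      then show "y \<in> insert a (X \<inter> {..?T})" using y by auto
    qed (use a_mem in auto)
    moreover have "a \<notin> X \<inter> {..?T}" using lt by simp
    ultimately have "card X = 2 * j + 2"
      using st by (metis (no_types, lifting) card_insert_disjoint finite_Int finite_atMost
          add_2_eq_Suc' add.commute Suc_1 add_Suc_right plus_1_eq_Suc)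
    moreover have n: "n = (j + 1) * (p + 1)" using ta a_less n_le by simp
    moreover have "n div (p + 1) = j + 1"
      by (subst n) (rule nonzero_mult_div_cancel_right, simp)
    moreover have "(p + 1) dvd n" by (subst n) (rule dvd_triv_right)
    ultimately show ?thesis by simp
  qed
qed

end


section \<open>Path ideals of cycles\<close>

lemma path_mono_Suc:
  "path_mono n (Suc p) i = path_mono n p i + Poly_Mapping.single ((i + p) mod n) 1"
  by (simp add: path_mono_def)

lemma mod_diff_eq_iff:
  assumes "c < n" "p < n"
  shows "(int c - int i) mod int n = int p \<longleftrightarrow> (i + p) mod n = c"
proof -
  have "(int c - int i) mod int n = int p \<longleftrightarrow> (int c - int i) mod int n = int p mod int n"
    using assms by simp
  also have "\<dots> \<longleftrightarrow> int c mod int n = int (i + p) mod int n"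
    by (simp add: mod_eq_dvd_iff algebra_simps)
  also have "\<dots> \<longleftrightarrow> (i + p) mod n = c"
    using assms by (metis mod_less nat_int of_nat_mod)
  finally show ?thesis .
qed

text \<open>The offset from \<open>i\<close> to \<open>c\<close> is taken in the integers, where
  subtraction is not truncated; \<open>p \<le> n\<close> keeps the path from visiting a vertex
  twice.\<close>

lemma lookup_path_mono:
  assumes "p \<le> n" "0 < n"
  shows "Poly_Mapping.lookup (path_mono n p i) c =
    (if c < n \<and> (int c - int i) mod int n < int p then 1 else 0)"
  using assms(1)
proof (induction p)
  case 0
  then show ?case using assms(2) by (simp add: path_mono_def not_less)
next
  case (Suc p)
  have "(i + p) mod n < n" using assms(2) by simp
  then have "Poly_Mapping.lookup (path_mono n (Suc p) i) c =
      (if c < n \<and> (int c - int i) mod int n < int p then 1 else 0) +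
      (if c < n \<and> (int c - int i) mod int n = int p then 1 else 0)"
    using Suc mod_diff_eq_iff[of c n p i]
    by (auto simp: path_mono_Suc lookup_add lookup_single when_def)
  then show ?case by auto
qed

lemma keys_path_mono:
  assumes "p \<le> n" "0 < n"
  shows "Poly_Mapping.keys (path_mono n p i) = {c. c < n \<and> (int c - int i) mod int n < int p}"
  by (auto simp: in_keys_iff lookup_path_mono[OF assms] split: if_splits)

text \<open>The position of vertex \<open>c\<close> on the cycle cut open before vertex
  \<open>u\<close>.\<close>

definition pos :: "nat \<Rightarrow> nat \<Rightarrow> nat \<Rightarrow> nat" where
  "pos n u c = nat ((int c - int u) mod int n)"

lemma pos_less: "0 < n \<Longrightarrow> pos n u c < n"
  by (simp add: pos_def nat_less_iff)

lemma pos_surj: "e < n \<Longrightarrow> pos n u ((u + e) mod n) = e"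
  using mod_diff_eq_iff[of "(u + e) mod n" n e u] by (simp add: pos_def)

lemma keys_path_mono_pos:
  assumes "p \<le> n" "r < n"
  shows "Poly_Mapping.keys (path_mono n p (u + r)) = {c. c < n \<and> pos n u c \<in> cyclic_arc n p r}"
proof -
  have "(int c - int (u + r)) mod int n < int p \<longleftrightarrow> pos n u c \<in> cyclic_arc n p r" for c
  proof -
    define e where "e = pos n u c"
    have e: "e < n" "int e = (int c - int u) mod int n"
      using assms(2) pos_less[of n u c] by (auto simp: e_def pos_def)
    have "(int c - int (u + r)) mod int n = (int e - int r) mod int n"
      unfolding e(2) by (simp add: mod_diff_left_eq algebra_simps)
    also have "\<dots> = (if r \<le> e then int e - int r else int e - int r + int n)"
    proof (cases "r \<le> e")
      case False
      have "(int e - int r) mod int n = (int e - int r + int n) mod int n" by simp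
      also have "\<dots> = int e - int r + int n" using False assms(2) e by (intro mod_pos_pos_trivial) auto
      finally show ?thesis using False by simp
    qed (use e in auto)
    finally show ?thesis using assms e(1) unfolding e_def[symmetric] by (auto simp: cyclic_arc_def)
  qed
  then show ?thesis using keys_path_mono[of p n "u + r"] assms by auto
qed

section \<open>The generators of the path ideal\<close>

lemma path_mono_cong:
  assumes "p \<le> n" "0 < n" "i mod n = j mod n"
  shows "path_mono n p i = path_mono n p j"
proof (rule poly_mapping_eqI)
  fix c
  have "int i mod int n = int j mod int n" using assms(3) by (metis of_nat_mod)
  then have "(int c - int i) mod int n = (int c - int j) mod int n"
    by (metis mod_diff_right_eq)
  then show "Poly_Mapping.lookup (path_mono n p i) c = Poly_Mapping.lookup (path_mono n p j) c"
    using assms(1,2) by (simp add: lookup_path_mono)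
qed

definition path_gens :: "nat \<Rightarrow> nat \<Rightarrow> mono set" where
  "path_gens n p = range (path_mono n p)"

lemma path_gens_eq:
  assumes "p \<le> n" "0 < n"
  shows "path_gens n p = (\<lambda>r. path_mono n p (u + r)) ` {..<n}"
proof -
  have "path_mono n p i \<in> (\<lambda>r. path_mono n p (u + r)) ` {..<n}" for i
  proof
    show "pos n u i \<in> {..<n}" using pos_less assms by simp
    have "int ((u + pos n u i) mod n) = int (i mod n)"
      using assms(2) by (simp add: pos_def of_nat_mod mod_add_right_eq)
    then have "(u + pos n u i) mod n = i mod n" by simp
    then show "path_mono n p i = path_mono n p (u + pos n u i)"
      using assms by (intro path_mono_cong) auto
  qed
  then show ?thesis by (auto simp: path_gens_def)
qed

lemma path_gens_monomials: "p \<le> n \<Longrightarrow> 0 < n \<Longrightarrow> path_gens n p \<subseteq> monomials n"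
  by (auto simp: path_gens_def monomials_def keys_path_mono)

lemma cyclic_arc_subset:
  assumes "cyclic_arc n p r \<subseteq> cyclic_arc n p s" "r < n" "s < n" "p < n" "0 < p"
  shows "r = s"
proof (rule ccontr)
  assume "r \<noteq> s"
  \<comment> \<open>The position just past the arc at \<open>s\<close>; an arc of the same length
    that starts inside, but not at \<open>s\<close>, runs over it.\<close>
  let ?e = "if s + p < n then s + p else s + p - n"
  have "r \<in> cyclic_arc n p s" using assms by (auto simp: cyclic_arc_def)
  then have "?e \<in> cyclic_arc n p r" using \<open>r \<noteq> s\<close> assms(2-5) by (auto simp: cyclic_arc_def)
  then have "?e \<in> cyclic_arc n p s" using assms(1) by blast
  then show False using assms(2-5) by (auto simp: cyclic_arc_def split: if_splits)
qed

lemma keys_path_mono_subset: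
  assumes "r < n" "s < n" "p < n" "0 < p"
    and sub: "Poly_Mapping.keys (path_mono n p (u + r)) \<subseteq> Poly_Mapping.keys (path_mono n p (u + s))"
  shows "r = s"
proof (rule cyclic_arc_subset)
  show "cyclic_arc n p r \<subseteq> cyclic_arc n p s"
  proof
    fix e assume e: "e \<in> cyclic_arc n p r"
    then have "pos n u ((u + e) mod n) = e" using pos_surj by (simp add: cyclic_arc_def)
    then have "(u + e) mod n \<in> Poly_Mapping.keys (path_mono n p (u + r))"
      using e assms by (simp add: keys_path_mono_pos)
    then have "(u + e) mod n \<in> Poly_Mapping.keys (path_mono n p (u + s))" using sub by blast
    then show "e \<in> cyclic_arc n p s"
      using \<open>pos n u ((u + e) mod n) = e\<close> assms by (simp add: keys_path_mono_pos)
  qed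
qed (use assms in auto)

text \<open>For \<open>p = n\<close> every path is the product of all variables, so starting
  positions no longer distinguish generators and this case is kept apart.\<close>

lemma path_gens_full:
  assumes "0 < n"
  shows "path_gens n n = {path_mono n n 0}"
proof -
  have "path_mono n n i = path_mono n n 0" for i
    by (rule poly_mapping_eqI) (use assms in \<open>simp add: lookup_path_mono\<close>)
  then show ?thesis by (auto simp: path_gens_def)
qed

lemma path_gens_antichain:
  assumes "0 < p" "p \<le> n" "m \<in> path_gens n p" "m' \<in> path_gens n p"
    "Poly_Mapping.keys m \<subseteq> Poly_Mapping.keys m'"
  shows "m = m'"
proof (cases "p = n")
  case True
  then show ?thesis using assms path_gens_full[of n] by auto
next
  case False
  then show ?thesis
    using assms path_gens_eq[of p n 0] keys_path_mono_subset[of _ n _ p 0] by auto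
qed

lemma min_gens_path_ideal:
  assumes "0 < p" "p \<le> n"
  shows "min_gens n (path_ideal n p :: ('k::field) mpoly set) = path_gens n p"
proof -
  have "path_gens n p = (\<lambda>r. path_mono n p (1 + r)) ` {..<n}"
    using assms by (intro path_gens_eq) auto
  also have "\<dots> = path_mono n p ` (Suc ` {..<n})" by (simp add: image_image)
  also have "Suc ` {..<n} = {1..n}" by (auto simp: image_iff Bex_def) presburger
  finally have eq: "path_mono n p ` {1..n} = path_gens n p" ..
  have "min_gens n (Idl\<^bsub>poly_ring n\<^esub> ((monom_poly :: mono \<Rightarrow> 'k mpoly) ` path_gens n p)) = path_gens n p"
  proof (rule min_gens_monomial_ideal)
    show "path_gens n p \<subseteq> monomials n" using assms by (intro path_gens_monomials) auto
    fix s t assume "s \<in> path_gens n p" "t \<in> path_gens n p" "mono_dvd s t"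
    moreover from this have "Poly_Mapping.keys s \<subseteq> Poly_Mapping.keys t"
      by (auto simp: mono_dvd_def in_keys_iff lookup_add)
    ultimately show "s = t" using path_gens_antichain assms by blast
  qed
  then show ?thesis unfolding path_ideal_def eq[symmetric] image_image .
qed

section \<open>Toggle-free cells for paths shorter than the cycle\<close>

locale path_cycle =
  fixes n p :: nat
  assumes p_pos: "0 < p" and p_less_n: "p < n"
begin

abbreviation gens where "gens \<equiv> path_gens n p"

text \<open>The position of a generator on the cycle cut open before vertex \<open>u\<close>.\<close>

definition rank :: "nat \<Rightarrow> mono \<Rightarrow> nat" where
  "rank u = the_inv_into {..<n} (\<lambda>r. path_mono n p (u + r))"

lemma inj_path_mono: "inj_on (\<lambda>r. path_mono n p (u + r)) {..<n}"
  using keys_path_mono_subset[of _ n _ p u] p_less_n p_pos by (auto intro!: inj_onI)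

lemma rank_path_mono: "r < n \<Longrightarrow> rank u (path_mono n p (u + r)) = r"
  unfolding rank_def using the_inv_into_f_f[OF inj_path_mono] by auto

lemma gens_eq: "gens = (\<lambda>r. path_mono n p (u + r)) ` {..<n}"
  using path_gens_eq p_less_n by simp

lemma rank_gens:
  assumes "m \<in> gens"
  shows "rank u m < n" "path_mono n p (u + rank u m) = m"
    "Poly_Mapping.keys m = {c. c < n \<and> pos n u c \<in> cyclic_arc n p (rank u m)}"
proof -
  obtain r where "r < n" "m = path_mono n p (u + r)" using assms gens_eq[of u] by auto
  then show "rank u m < n" "path_mono n p (u + rank u m) = m"
    "Poly_Mapping.keys m = {c. c < n \<and> pos n u c \<in> cyclic_arc n p (rank u m)}"
    using rank_path_mono keys_path_mono_pos p_less_n by auto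
qed

lemma inj_rank: "inj_on (rank u) gens"
  by (rule inj_onI) (metis rank_gens(2))

lemma ranked: "ranked_gens gens (rank u)"
proof
  show "finite gens" using gens_eq[of 0] by simp
  show "inj_on (rank u) gens" by (rule inj_rank)
  show "Poly_Mapping.lookup m i \<le> 1" if "m \<in> gens" for m i
    using that p_less_n by (auto simp: path_gens_def lookup_path_mono)
  show "m = m'" if "m \<in> gens" "m' \<in> gens" "Poly_Mapping.keys m \<subseteq> Poly_Mapping.keys m'" for m m'
    using path_gens_antichain[OF p_pos _ that] p_less_n by simp
  fix b m x a assume G: "b \<in> gens" "m \<in> gens" "x \<in> gens" "a \<in> gens"
    and lt: "rank u b < rank u m" "rank u m < rank u x" "rank u x < rank u a"
  show "Poly_Mapping.keys b \<inter> Poly_Mapping.keys x \<subseteq> Poly_Mapping.keys m \<union> Poly_Mapping.keys a"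
    using lt p_less_n rank_gens(1)[OF G(4), of u]
    unfolding rank_gens(3)[OF G(1), of u] rank_gens(3)[OF G(2), of u]
      rank_gens(3)[OF G(3), of u] rank_gens(3)[OF G(4), of u]
    by (auto simp: cyclic_arc_def)
qed

sublocale ranked_gens gens "rank u" for u
  by (rule ranked)

lemma cover_eq: "\<sigma> \<subseteq> gens \<Longrightarrow> cover \<sigma> = {c. c < n \<and> (\<exists>m\<in>\<sigma>. pos n u c \<in> cyclic_arc n p (rank u m))}"
  using rank_gens(3)[of _ u] unfolding cover_def by blast

text \<open>With \<open>u\<close> missing, no arc of either cell passes the cut, so the end of the
  arc of \<open>a\<close> must be covered by an arc of \<open>\<sigma>'\<close> that starts no
  earlier.\<close>

lemma max_rank_le:
  assumes \<sigma>: "\<sigma> \<subseteq> gens" and \<sigma>': "\<sigma>' \<subseteq> gens" and eq: "cover \<sigma> = cover \<sigma>'"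
    and u: "u < n" "u \<notin> cover \<sigma>"
    and a: "a \<in> \<sigma>" and a': "\<And>s. s \<in> \<sigma>' \<Longrightarrow> rank u s \<le> rank u a'"
  shows "rank u a \<le> rank u a'"
proof -
  have u0: "pos n u u = 0" by (simp add: pos_def)
  have nowrap: "rank u m + p \<le> n" if "m \<in> \<sigma> \<or> m \<in> \<sigma>'" for m
  proof -
    have "m \<in> gens" "u \<notin> Poly_Mapping.keys m" using that \<sigma> \<sigma>' u eq by (auto simp: cover_def)
    then show ?thesis using rank_gens(1,3)[of m u] u(1) u0 by (auto simp: cyclic_arc_def)
  qed
  let ?e = "rank u a + p - 1"
  let ?c = "(u + ?e) mod n"
  have e: "?e < n" using nowrap[of a] a p_pos by auto
  have pe: "pos n u ?c = ?e" using e by (rule pos_surj)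
  have "?e \<in> cyclic_arc n p (rank u a)" using e p_pos by (auto simp: cyclic_arc_def)
  then have "?c \<in> cover \<sigma>"
    unfolding cover_eq[OF \<sigma>, of u] using a e pe by auto
  then obtain y where y: "y \<in> \<sigma>'" "pos n u ?c \<in> cyclic_arc n p (rank u y)"
    unfolding eq cover_eq[OF \<sigma>', of u] by blast
  from y(2) have "?e \<in> cyclic_arc n p (rank u y)" unfolding pe .
  then show ?thesis using nowrap[of y] y(1) a'[OF y(1)] p_pos by (auto simp: cyclic_arc_def)
qed

text \<open>Passes to the set of starting positions; with the cut at \<open>0\<close>, vertices and
  positions agree.\<close>

lemma toggle_free_full_card:
  assumes \<sigma>: "\<sigma> \<subseteq> gens" and tf: "\<And>m. \<not> toggle 0 \<sigma> m" and full: "{..<n} \<subseteq> cover \<sigma>"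
  shows "card \<sigma> = (if (p + 1) dvd n then 2 * (n div (p + 1)) else 2 * (n div (p + 1)) + 1)"
proof -
  let ?f = "path_mono n p" and ?X = "rank 0 ` \<sigma>" and ?C = "cyclic_arc n p"
  have pos0: "pos n 0 c = c" if "c < n" for c using that by (simp add: pos_def)
  have f: "rank 0 (?f r) = r" if "r < n" for r using rank_path_mono[of r 0] that by simp
  have f_gens: "?f r \<in> gens" for r by (simp add: path_gens_def)
  have keys: "Poly_Mapping.keys m = ?C (rank 0 m)" if "m \<in> gens" for m
    unfolding rank_gens(3)[OF that, of 0] using pos0 by (auto simp: cyclic_arc_def)
  have finX: "finite ?X" using finite_cell[OF \<sigma>] by simp
  obtain c where "c \<in> \<sigma>" using full p_less_n by (fastforce simp: cover_def)
  then have neX: "?X \<noteq> {}" by blast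
  have cov: "cover \<tau> = (\<Union>r\<in>rank 0 ` \<tau>. ?C r)" if "\<tau> \<subseteq> gens" for \<tau>
    unfolding cover_def using keys that by auto
  have bridge: "b \<in> bridges \<tau> \<longleftrightarrow> b \<in> \<tau> \<and> ?C (rank 0 b) \<subseteq> (\<Union>r\<in>rank 0 ` \<tau> - {rank 0 b}. ?C r)"
    if \<tau>: "\<tau> \<subseteq> gens" for b \<tau>
  proof (cases "b \<in> \<tau>")
    case True
    have "rank 0 ` (\<tau> - {b}) = rank 0 ` \<tau> - {rank 0 b}"
      using inj_on_image_set_diff[OF inj_rank[of 0], of \<tau> "{b}"] True \<tau> by auto
    moreover have "\<tau> - {b} \<subseteq> gens" "b \<in> gens" using True \<tau> by auto
    ultimately show ?thesis using bridges_iff[OF \<tau>, of b] cov[of "\<tau> - {b}"] keys[of b] by simp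
  qed (use bridges_subset in blast)
  interpret toggle_free_cycle n p "Max ?X" ?X
  proof
    show "p < n" by (rule p_less_n)
    show "?X \<subseteq> {..<n}" using rank_gens(1) \<sigma> by auto
    show "\<exists>r\<in>?X. e \<in> ?C r" if "e < n" for e using full that cov[OF \<sigma>] by auto
    show "Max ?X \<in> ?X" using finX neX by (rule Max_in)
    show "r \<le> Max ?X" if "r \<in> ?X" for r using finX that by (rule Max_ge)
    fix m assume m: "m < Max ?X" and sub: "?C m \<subseteq> (\<Union>r\<in>?X - {m}. ?C r)"
    obtain a where a: "a \<in> \<sigma>" "rank 0 a = Max ?X" using Max_in[OF finX neX] by auto
    have mn: "m < n" using m rank_gens(1)[of a 0] a \<sigma> by auto
    let ?\<tau> = "insert (?f m) \<sigma>"
    have \<tau>: "?\<tau> \<subseteq> gens" using \<sigma> f_gens by auto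
    have r\<tau>: "rank 0 ` ?\<tau> = insert m ?X" using f[OF mn] by simp
    have "insert m ?X - {m} = ?X - {m}" by auto
    then have "?f m \<in> bridges ?\<tau>" using bridge[OF \<tau>, of "?f m"] sub r\<tau> f[OF mn] by simp
    then obtain b where b: "b \<in> bridges ?\<tau>" "rank 0 b < m"
      using tf[of "?f m"] a m f_gens f[OF mn] by (auto simp: toggle_def not_le)
    have "rank 0 b \<in> insert m ?X" using b(1) bridges_subset r\<tau> by blast
    moreover have "?C (rank 0 b) \<subseteq> (\<Union>r\<in>insert m ?X - {rank 0 b}. ?C r)"
      using b(1) bridge[OF \<tau>, of b] r\<tau> by simp
    ultimately show "\<exists>b\<in>insert m ?X. b < m \<and> ?C b \<subseteq> (\<Union>r\<in>insert m ?X - {b}. ?C r)"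
      using b(2) by blast
  qed
  have "card \<sigma> = card ?X" using card_image[OF inj_on_subset[OF inj_rank \<sigma>]] by simp
  then show ?thesis using card_X by simp
qed

text \<open>With a missing vertex both cells have the same last generator and hence coincide; the
  empty cell, which has none, is treated apart. With a full lcm the count decides.\<close>

lemma toggle_free_card:
  assumes \<sigma>: "\<sigma> \<subseteq> gens" "\<And>m. \<not> toggle u \<sigma> m" and \<sigma>': "\<sigma>' \<subseteq> gens" "\<And>m. \<not> toggle u \<sigma>' m"
    and eq: "mlcm \<sigma> = mlcm \<sigma>'"
    and u: "u < n \<and> u \<notin> Poly_Mapping.keys (mlcm \<sigma>) \<or> u = 0 \<and> {..<n} \<subseteq> Poly_Mapping.keys (mlcm \<sigma>)"
  shows "card \<sigma> = card \<sigma>'"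
proof -
  have cov: "cover \<sigma> = cover \<sigma>'" using mlcm_eq_iff[OF \<sigma>(1) \<sigma>'(1)] eq by simp
  have keys: "Poly_Mapping.keys (mlcm \<sigma>) = cover \<sigma>"
    using keys_mlcm[OF finite_cell[OF \<sigma>(1)]] by (simp add: cover_def)
  show ?thesis
  proof (cases "u = 0 \<and> {..<n} \<subseteq> cover \<sigma>")
    case True
    then show ?thesis using toggle_free_full_card \<sigma> \<sigma>' cov by simp
  next
    case False
    then have u': "u < n" "u \<notin> cover \<sigma>" using u keys by auto
    have empty: "cover \<tau> = {} \<longleftrightarrow> \<tau> = {}" if "\<tau> \<subseteq> gens" for \<tau>
    proof -
      have "Poly_Mapping.keys m \<noteq> {}" if m: "m \<in> gens" for m
      proof -
        let ?r = "rank 0 m"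
        have "?r < n" "?r \<in> cyclic_arc n p ?r"
          using rank_gens(1)[OF m, of 0] p_pos by (auto simp: cyclic_arc_def)
        then have "?r \<in> Poly_Mapping.keys m"
          unfolding rank_gens(3)[OF m, of 0] by (simp add: pos_def)
        then show ?thesis by blast
      qed
      then show ?thesis using that by (auto simp: cover_def)
    qed
    show ?thesis
    proof (cases "\<sigma> = {}")
      case True
      then have "\<sigma>' = {}" using empty[OF \<sigma>(1)] empty[OF \<sigma>'(1)] cov by simp
      then show ?thesis using True by simp
    next
      case ne: False
      have ne': "\<sigma>' \<noteq> {}" using empty[OF \<sigma>(1)] empty[OF \<sigma>'(1)] cov ne by simp
      have max: "\<exists>a\<in>\<tau>. \<forall>s\<in>\<tau>. rank u s \<le> rank u a" if \<tau>: "\<tau> \<subseteq> gens" "\<tau> \<noteq> {}" for \<tau>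
      proof -
        have "finite (rank u ` \<tau>)" using finite_cell[OF \<tau>(1)] by simp
        then have "Max (rank u ` \<tau>) \<in> rank u ` \<tau>" "\<forall>s\<in>\<tau>. rank u s \<le> Max (rank u ` \<tau>)"
          using \<tau>(2) by simp_all
        then show ?thesis by (metis imageE)
      qed
      obtain a where a: "a \<in> \<sigma>" "\<And>s. s \<in> \<sigma> \<Longrightarrow> rank u s \<le> rank u a"
        using max[OF \<sigma>(1) ne] by blast
      obtain a' where a': "a' \<in> \<sigma>'" "\<And>s. s \<in> \<sigma>' \<Longrightarrow> rank u s \<le> rank u a'"
        using max[OF \<sigma>'(1) ne'] by blast
      have "rank u a \<le> rank u a'" by (rule max_rank_le[OF \<sigma>(1) \<sigma>'(1) cov u' a(1) a'(2)])
      moreover have "rank u a' \<le> rank u a"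
        using u' cov by (intro max_rank_le[OF \<sigma>'(1) \<sigma>(1) cov[symmetric] _ _ a'(1) a(2)]) auto
      ultimately have "a = a'" using inj_onD[OF inj_rank[of u], of a a'] a(1) a'(1) \<sigma>(1) \<sigma>'(1) by auto
      then have "\<sigma> = \<sigma>'" using a a' by (intro toggle_free_unique[OF \<sigma> \<sigma>' eq, of a]) auto
      then show ?thesis by simp
    qed
  qed
qed

text \<open>On a proper part of the cycle the order starts behind a missing vertex; the \<open>SOME\<close> is
  used only if there is one.\<close>

definition cut :: "mono \<Rightarrow> nat" where
  "cut v = (if {..<n} \<subseteq> Poly_Mapping.keys v then 0 else SOME u. u < n \<and> u \<notin> Poly_Mapping.keys v)"

definition order :: "mono \<Rightarrow> mono rel" where
  "order v = rank_order gens (rank (cut v))"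

lemma cut: "cut v < n \<and> cut v \<notin> Poly_Mapping.keys v \<or> cut v = 0 \<and> {..<n} \<subseteq> Poly_Mapping.keys v"
proof (cases "{..<n} \<subseteq> Poly_Mapping.keys v")
  case False
  then have "\<exists>u. u < n \<and> u \<notin> Poly_Mapping.keys v" by auto
  then show ?thesis using someI_ex[of "\<lambda>u. u < n \<and> u \<notin> Poly_Mapping.keys v"] False
    by (simp add: cut_def)
qed (simp add: cut_def)

lemma critical_card:
  assumes \<sigma>: "\<sigma> \<in> critical gens (gbm_matching n gens order) r"
    and \<tau>: "\<tau> \<in> critical gens (gbm_matching n gens order) s" and eq: "mlcm \<sigma> = mlcm \<tau>"
  shows "r = s"
proof -
  have sub: "\<sigma> \<subseteq> gens" "\<tau> \<subseteq> gens" and cards: "card \<sigma> = r" "card \<tau> = s"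
    using \<sigma> \<tau> by (auto simp: critical_def)
  have "gens \<subseteq> monomials n" using path_gens_monomials p_less_n by simp
  then have "mlcm \<sigma> \<in> monomials n"
    using mlcm_in_monomials[OF finite_cell[OF sub(1)]] sub(1) by blast
  then have "bm_edges gens (rank_order gens (rank (cut (mlcm \<sigma>)))) (mlcm \<sigma>) \<subseteq> gbm_matching n gens order"
    by (auto simp: gbm_matching_def order_def)
  then have "\<And>m. \<not> toggle (cut (mlcm \<sigma>)) \<sigma> m" "\<And>m. \<not> toggle (cut (mlcm \<sigma>)) \<tau> m"
    using critical_toggle_free[OF \<sigma>] critical_toggle_free[OF \<tau>] eq by auto
  then have "card \<sigma> = card \<tau>" using toggle_free_card sub eq cut by blast
  then show ?thesis using cards by simp
qed

end

text \<open>Common to the cases \<open>p = n\<close> and \<open>p < n\<close>.\<close>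

lemma gbm_minimal_path_idealI:
  fixes ori :: "mono rel"
  assumes "0 < p" "p \<le> n"
    and ord: "\<And>v. \<exists>\<rho>. inj_on \<rho> (path_gens n p) \<and> succ v = rank_order (path_gens n p) \<rho>"
    and crit: "\<And>r s \<sigma> \<tau>. \<sigma> \<in> critical (path_gens n p) (gbm_matching n (path_gens n p) succ) r \<Longrightarrow>
      \<tau> \<in> critical (path_gens n p) (gbm_matching n (path_gens n p) succ) s \<Longrightarrow>
      mlcm \<sigma> = mlcm \<tau> \<Longrightarrow> r = s"
  shows "(\<forall>v \<in> monomials n. strict_linear_order_on (path_gens n p) (succ v)) \<and>
    gbm_minimal n (path_ideal n p :: ('k::field) mpoly set) ori succ"
proof
  show "\<forall>v \<in> monomials n. strict_linear_order_on (path_gens n p) (succ v)"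
    using ord strict_linear_order_rank_order by metis
  have fin: "finite (path_gens n p)" using path_gens_eq[of p n 0] assms by simp
  show "gbm_minimal n (path_ideal n p :: 'k mpoly set) ori succ"
    unfolding gbm_minimal_def Let_def min_gens_path_ideal[OF assms(1,2)]
  proof (rule minimal_complexI[OF fin])
    show "path_gens n p \<subseteq> monomials n" using path_gens_monomials assms by simp
    show "mlcm \<sigma> = mlcm \<tau>" if "(\<sigma>, \<tau>) \<in> gbm_matching n (path_gens n p) succ" for \<sigma> \<tau>
      by (rule gbm_matching_homogeneous[OF fin ord that])
  qed (rule crit)
qed

theorem theorem4p16:
  fixes n p :: nat and I :: "('k::field) mpoly set" and ori :: "mono rel"
  assumes "2 \<le> p" and "p \<le> n"
    and "I = path_ideal n p"
    and "strict_linear_order_on (min_gens n I) ori"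
  shows "\<exists>succ :: mono \<Rightarrow> mono rel.
           (\<forall>v \<in> monomials n. strict_linear_order_on (min_gens n I) (succ v)) \<and>
           gbm_minimal n I ori succ"
proof -
  have p: "0 < p" using assms(1) by simp
  have G: "min_gens n I = path_gens n p"
    unfolding assms(3) using p assms(2) by (rule min_gens_path_ideal)
  show ?thesis
  proof (cases "p = n")
    case True
    let ?G = "path_gens n p"
    have single: "?G = {path_mono n n 0}" using path_gens_full p True by simp
    \<comment> \<open>The only cells are the empty one and \<open>?G\<close>, and their lcms
      differ.\<close>
    have "r = s" if "\<sigma> \<in> critical ?G A r" "\<tau> \<in> critical ?G A s" "mlcm \<sigma> = mlcm \<tau>" for A r s \<sigma> \<tau>
    proof -
      have sub: "\<sigma> = {} \<or> \<sigma> = ?G" "\<tau> = {} \<or> \<tau> = ?G"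
        using that(1,2) unfolding single by (auto simp: critical_def)
      have "0 \<in> Poly_Mapping.keys (path_mono n n 0)"
        using p True by (simp add: keys_path_mono)
      then have "mlcm ?G \<noteq> mlcm {}"
        using keys_mlcm[of ?G] keys_mlcm[of "{}"] unfolding single by auto
      then have "\<sigma> = \<tau>" using sub that(3) by metis
      then show ?thesis using that(1,2) by (simp add: critical_def)
    qed
    \<comment> \<open>On a single generator the constant rank is injective.\<close>
    then show ?thesis unfolding G unfolding assms(3)
      using gbm_minimal_path_idealI[OF p assms(2), of "\<lambda>_. rank_order ?G (\<lambda>_. 0)" ori]
      by (intro exI[of _ "\<lambda>_. rank_order ?G (\<lambda>_. 0)"]) (auto simp: single)
  next
    case False
    then interpret path_cycle n p using p assms(2) by unfold_locales auto
    show ?thesis unfolding G unfolding assms(3)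
    proof (rule exI, rule gbm_minimal_path_idealI[OF p assms(2)])
      show "\<exists>\<rho>. inj_on \<rho> gens \<and> order v = rank_order gens \<rho>" for v
        using inj_rank order_def by blast
    qed (rule critical_card)
  qed
qed

end
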